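(* Let $G$ be a finite connected graph with girth $\gamma$. Then for any choice of edge lengths $\ell:E(G)\to\mathbb{R}_{>0}$ and any integer $d\geq\gamma$, the metric graph $\Gamma=(G,\ell)$ does not satisfy the Manin--Mumford condition in degree $d$.
   Context: Graphs may have loops and multiple edges. A cycle of a graph is a subgraph homeomorphic to a circle; the girth $\gamma(G)$ is the minimal number of edges in a cycle of $G$ (and $+\infty$ if $G$ has no cycle). A metric graph $\Gamma=(G,\ell)$ is the compact connected metric space obtained from a finite connected graph $G$ with edge lengths $\ell:E(G)\to\mathbb{R}_{>0}$ by identifying each edge $e$ with a closed interval $[0,\ell(e)]$ and taking the path metric; $(G,\ell)$ is then called a model of $\Gamma$ (a metric graph has many models). $\mathrm{Div}(\Gamma)$ is the free abelian group on the points of $\Gamma$, $\deg$ is the sum of coefficients, $\mathrm{Div}^0(\Gamma)=\ker(\deg)$, and a divisor is effective if all its coefficients are nonnegative. $\mathrm{PL}_{\mathbb{Z}}(\Gamma)$ is the set of continuous functions $f:\Gamma\to\mathbb{R}$ that are linear with integer slope (with respect to arc length) on each edge of some model of $\Gamma$. For such $f$, $\Delta(f)=-\sum_{x\in\Gamma}a_x\,x$, where $a_x$ is the sum of the outgoing slopes of $f$ at $x$. The Jacobian is $\mathrm{Jac}(\Gamma)=\mathrm{Div}^0(\Gamma)/\Delta(\mathrm{PL}_{\mathbb{Z}}(\Gamma))$, and $\mathrm{Jac}(\Gamma)_{\mathrm{tors}}$ is its torsion subgroup. For an effective divisor $D$ of degree $d$, the degree $d$ Abel--Jacobi map is $\iota_D^{(d)}:\Gamma^d\to\mathrm{Jac}(\Gamma)$,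 $(p_1,\ldots,p_d)\mapsto[p_1+\cdots+p_d-D]$. $\Gamma$ satisfies the Manin--Mumford condition in degree $d$ if $\iota_D^{(d)}(\Gamma^d)\cap\mathrm{Jac}(\Gamma)_{\mathrm{tors}}$ is finite for every effective degree $d$ divisor class $[D]$. *)

theory Defs
  imports
    "HOL-Analysis.Analysis"
    "HOL-Algebra.Free_Abelian_Groups"
    "HOL-Library.Extended_Nat"
    "Graph_Theory.Digraph_Component"
begin

text \<open>
  A graph, possibly with loops and multiple edges, is given by a directed multigraph. The
  orientation only serves to parametrise the edges: the edge \<open>e\<close> is identified with
  \<open>[0, len e]\<close> so that 0 is its tail. All notions below ignore it; in particular
  \<^const>\<open>Digraph_Component.connected\<close> is connectedness of the symmetrised graph, and it
  includes that there is at least one vertex.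
\<close>

section \<open>Metric graphs\<close>

text \<open>
  The quotient of the disjoint union of the vertices and the intervals \<open>[0, len e]\<close>, with one
  canonical representative for each class: either a vertex, or an edge together with a
  parameter strictly between the end points. The quotient map on the interval of
  \<open>e\<close> is \<open>edge_point G len e\<close>.
\<close>

datatype ('v, 'e) gpoint = Vertex 'v | Inner 'e real

definition points :: "('v, 'e) pre_digraph \<Rightarrow> ('e \<Rightarrow> real) \<Rightarrow> ('v, 'e) gpoint set" where
  "points G len = Vertex ` verts G \<union> {Inner e t | e t. e \<in> arcs G \<and> 0 < t \<and> t < len e}"

definition edge_point :: "('v, 'e) pre_digraph \<Rightarrow> ('e \<Rightarrow> real) \<Rightarrow> 'e \<Rightarrow> real \<Rightarrow> ('v, 'e) gpoint" where
  "edge_point G len e t =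
    (if t \<le> 0 then Vertex (tail G e) else if len e \<le> t then Vertex (head G e) else Inner e t)"

text \<open>
  \<open>joined G len x L y\<close>: there is a path of length \<open>L\<close> from \<open>x\<close> to \<open>y\<close>, made of finitely many
  segments, each of which lies in one edge.
\<close>

inductive joined ::
  "('v, 'e) pre_digraph \<Rightarrow> ('e \<Rightarrow> real) \<Rightarrow> ('v, 'e) gpoint \<Rightarrow> real \<Rightarrow> ('v, 'e) gpoint \<Rightarrow> bool"
  for G len where
  joined_refl: "x \<in> points G len \<Longrightarrow> joined G len x 0 x"
| joined_step: "joined G len x L (edge_point G len e s) \<Longrightarrow> e \<in> arcs G \<Longrightarrow>
    s \<in> {0..len e} \<Longrightarrow> t \<in> {0..len e} \<Longrightarrow>
    joined G len x (L + \<bar>s - t\<bar>) (edge_point G len e t)"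

text \<open>The locale \<^locale>\<open>Metric_space\<close> wants a nonnegative value also outside of the space.\<close>

definition path_dist ::
  "('v, 'e) pre_digraph \<Rightarrow> ('e \<Rightarrow> real) \<Rightarrow> ('v, 'e) gpoint \<Rightarrow> ('v, 'e) gpoint \<Rightarrow> real" where
  "path_dist G len x y =
    (if x \<in> points G len \<and> y \<in> points G len then Inf {L. joined G len x L y} else 0)"

lemma edge_point_in_points:
  assumes "wf_digraph G" "e \<in> arcs G"
  shows "edge_point G len e t \<in> points G len"
  using assms by (auto simp: edge_point_def points_def wf_digraph.head_in_verts wf_digraph.tail_in_verts)

lemma points_cases:
  assumes "y \<in> points G len"
  obtains v where "y = Vertex v" "v \<in> verts G"
  | e t where "y = Inner e t" "e \<in> arcs G" "0 < t" "t < len e" "y = edge_point G len e t"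
  using assms by (auto simp: edge_point_def points_def)

lemma joined_points:
  assumes "wf_digraph G" "joined G len x L y"
  shows "x \<in> points G len \<and> y \<in> points G len \<and> 0 \<le> L"
  using assms(2) by induction (auto simp: edge_point_in_points assms(1))

lemma joined_trans:
  assumes "joined G len y L' z" "joined G len x L y"
  shows "joined G len x (L + L') z"
  using assms(1,2)
proof induction
  case (joined_step y L' e s t)
  then show ?case using joined.joined_step[of G len x "L + L'" e s t] by (simp add: add.assoc)
qed simp

lemma joined_edge:
  assumes "wf_digraph G" "e \<in> arcs G" "s \<in> {0..len e}" "t \<in> {0..len e}"
  shows "joined G len (edge_point G len e s) \<bar>s - t\<bar> (edge_point G len e t)"
  using joined_step[OF joined_refl[OF edge_point_in_points[OF assms(1,2), of len s]] assms(2,3,4)] by simp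

lemma joined_sym:
  assumes "wf_digraph G" "joined G len x L y"
  shows "joined G len y L x"
  using assms(2)
proof induction
  case (joined_step x L e s t)
  have "joined G len (edge_point G len e t) \<bar>t - s\<bar> (edge_point G len e s)"
    using joined_step by (intro joined_edge assms)
  from joined_trans[OF joined_step.IH this] show ?case by (simp add: abs_minus_commute add.commute)
qed (rule joined_refl)

lemma joined_lipschitz:
  assumes "joined G len x L y"
    and "\<And>e s t. e \<in> arcs G \<Longrightarrow> s \<in> {0..len e} \<Longrightarrow> t \<in> {0..len e} \<Longrightarrow>
      g (edge_point G len e t) \<le> g (edge_point G len e s) + \<bar>s - t\<bar>"
  shows "g y \<le> g x + (L :: real)"
  using assms(1)
proof induction
  case (joined_step x L e s t)
  then show ?case using assms(2)[of e s t] by simp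
qed simp

lemma joined_ex:
  assumes "wf_digraph G" "Digraph_Component.connected G" "\<forall>e \<in> arcs G. 0 < len e"
    and "x \<in> points G len" "y \<in> points G len"
  shows "\<exists>L. joined G len x L y"
proof -
  have len0: "0 < len e" if "e \<in> arcs G" for e using assms(3) that by blast
  have arc: "\<exists>L. joined G len (Vertex u) L (Vertex v)"
    if uv: "(u, v) \<in> arcs_ends G" for u v
  proof -
    obtain e where e: "e \<in> arcs G" "u = tail G e" "v = head G e"
      using uv by (auto simp: arcs_ends_def arc_to_ends_def)
    show ?thesis using joined_edge[OF assms(1) e(1), of 0 len "len e"] len0[OF e(1)] e
      by (auto simp: edge_point_def)
  qed
  have v: "\<exists>L. joined G len (Vertex u) L (Vertex v)" if "u \<in> verts G" "v \<in> verts G" for u v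
  proof -
    have "u \<rightarrow>\<^sup>*\<^bsub>with_proj (mk_symmetric G)\<^esub> v"
      using assms(2) that by (auto simp: Digraph_Component.connected_def elim!: strongly_connectedE)
    then have "(u, v) \<in> rtrancl_on (verts G) (parcs (mk_symmetric G))"
      by (simp add: reachable_def)
    then show ?thesis
    proof (induction rule: converse_rtrancl_on_induct)
      case (step v' w)
      obtain L where L: "joined G len (Vertex w) L (Vertex v)" using step by blast
      have "(v', w) \<in> arcs_ends G \<or> (w, v') \<in> arcs_ends G"
        using step by (auto simp: parcs_mk_symmetric arcs_ends_def arc_to_ends_def)
      then obtain L' where "joined G len (Vertex v') L' (Vertex w)"
        using arc joined_sym[OF assms(1)] by blast
      from joined_trans[OF L this] show ?case by blast
    qed (auto intro!: exI joined_refl simp: points_def)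
  qed
  have p: "\<exists>u L. u \<in> verts G \<and> joined G len x L (Vertex u)" if "x \<in> points G len" for x
    using that
  proof (cases rule: points_cases)
    case (1 v)
    then show ?thesis using that joined_refl by blast
  next
    case (2 e t)
    have "joined G len (edge_point G len e t) \<bar>t - 0\<bar> (edge_point G len e 0)"
      using 2 by (intro joined_edge assms) auto
    then show ?thesis using 2 wf_digraph.tail_in_verts[OF assms(1), of e] by (auto simp: edge_point_def)
  qed
  obtain u L u' L' where "u \<in> verts G" "joined G len x L (Vertex u)"
    "u' \<in> verts G" "joined G len y L' (Vertex u')" using p[OF assms(4)] p[OF assms(5)] by blast
  moreover obtain M where "joined G len (Vertex u) M (Vertex u')" using v calculation by blast
  ultimately show ?thesis by (blast intro: joined_trans joined_sym[OF assms(1)])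
qed

lemma separating_function:
  assumes "fin_digraph G" "\<forall>e \<in> arcs G. 0 < len e" "x \<in> points G len"
  obtains g :: "('v, 'e) gpoint \<Rightarrow> real" where "g x = 0"
    "\<And>y. y \<in> points G len \<Longrightarrow> y \<noteq> x \<Longrightarrow> 0 < g y"
    "\<And>e s t. e \<in> arcs G \<Longrightarrow> s \<in> {0..len e} \<Longrightarrow> t \<in> {0..len e} \<Longrightarrow>
      g (edge_point G len e t) \<le> g (edge_point G len e s) + \<bar>s - t\<bar>"
  using assms(3)
proof (cases rule: points_cases)
  case (1 v)
  define d where "d = Min (insert 1 (len ` arcs G))"
  have fin: "finite (arcs G)" using assms(1) by (rule fin_digraph.finite_arcs)
  have d: "0 < d" "\<And>e. e \<in> arcs G \<Longrightarrow> d \<le> len e"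
    unfolding d_def using fin assms(2) by auto
  define h where "h = (\<lambda>e t. min d (min (if tail G e = v then t else d)
    (if head G e = v then len e - t else d)))"
  define g where "g = (\<lambda>y. case y of Vertex w \<Rightarrow> if w = v then 0 else d | Inner e t \<Rightarrow> h e t)"
  have gh: "g (edge_point G len e t) = h e t" if "e \<in> arcs G" "t \<in> {0..len e}" for e t
    using that d(1) d(2)[of e] by (auto simp: g_def h_def edge_point_def)
  have "h e t \<le> h e s + \<bar>s - t\<bar>" for e s t unfolding h_def by auto
  then show ?thesis
    by (intro that[of g]) (auto simp: gh, auto simp: g_def 1 h_def points_def d(1) split: if_splits)
next
  case (2 e0 t0)
  define d where "d = min t0 (len e0 - t0)"
  have d: "0 < d" unfolding d_def using 2 by auto
  define h where "h = (\<lambda>e t. if e = e0 then min d \<bar>t - t0\<bar> else d)"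
  define g where "g = (\<lambda>y :: ('v, 'e) gpoint. case y of Vertex w \<Rightarrow> d | Inner e t \<Rightarrow> h e t)"
  have gh: "g (edge_point G len e t) = h e t" if "e \<in> arcs G" "t \<in> {0..len e}" for e t
    using that 2 by (auto simp: g_def h_def edge_point_def d_def)
  have "h e t \<le> h e s + \<bar>s - t\<bar>" for e s t unfolding h_def using d by auto
  then show ?thesis using d
    by (intro that[of g]) (auto simp: gh, auto simp: g_def 2 h_def points_def split: if_splits)
qed

lemma Metric_space_path_dist:
  assumes "fin_digraph G" "Digraph_Component.connected G" "\<forall>e \<in> arcs G. 0 < len e"
  shows "Metric_space (points G len) (path_dist G len)"
proof -
  have wf: "wf_digraph G" using assms(1) by (simp add: fin_digraph_def)
  have ne: "{L. joined G len x L y} \<noteq> {}" if "x \<in> points G len" "y \<in> points G len" for x y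
    using joined_ex[OF wf assms(2,3) that] by blast
  have bdd: "bdd_below {L. joined G len x L y}" for x y
    using joined_points[OF wf] by (intro bdd_belowI[of _ 0]) blast
  show ?thesis
  proof
    show nonneg: "0 \<le> path_dist G len x y" for x y
      using ne[of x y] joined_points[OF wf] unfolding path_dist_def by (auto intro!: cInf_greatest)
    show "path_dist G len x y = path_dist G len y x" for x y
    proof -
      have "joined G len x L y = joined G len y L x" for L
        using joined_sym[OF wf] by blast
      then show ?thesis by (simp add: path_dist_def)
    qed
    fix x y z assume x: "x \<in> points G len" and y: "y \<in> points G len"
    note pd = path_dist_def if_P[OF conjI[OF x y]]
    show "path_dist G len x y = 0 \<longleftrightarrow> x = y"
    proof
      assume 0: "path_dist G len x y = 0"
      obtain g where g: "g x = 0" "\<And>y. y \<in> points G len \<Longrightarrow> y \<noteq> x \<Longrightarrow> 0 < g y"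
        "\<And>e s t. e \<in> arcs G \<Longrightarrow> s \<in> {0..len e} \<Longrightarrow> t \<in> {0..len e} \<Longrightarrow>
          g (edge_point G len e t) \<le> g (edge_point G len e s) + \<bar>s - t\<bar>"
        using separating_function[OF assms(1,3) x] by blast
      have "g y \<le> path_dist G len x y" unfolding pd
        using joined_lipschitz[of G len x _ y g] g by (intro cInf_greatest ne x y) auto
      then show "x = y" using 0 g(2)[OF y] by force
    next
      assume "x = y"
      then have "path_dist G len x y \<le> 0" unfolding pd
        using joined_refl[OF x] by (intro cInf_lower bdd) auto
      then show "path_dist G len x y = 0" using nonneg[of x y] by simp
    qed
    assume z: "z \<in> points G len"
    have tri: "Inf {L. joined G len x L z} \<le> L + L'"
      if "joined G len x L y" "joined G len y L' z" for L L'
      using joined_trans[OF that(2,1)] by (intro cInf_lower bdd) auto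
    have "Inf {L. joined G len x L z} - L \<le> Inf {L. joined G len y L z}"
      if "joined G len x L y" for L
    proof (intro cInf_greatest ne y z)
      fix L' assume "L' \<in> {L. joined G len y L z}"
      then show "Inf {L. joined G len x L z} - L \<le> L'" using tri[OF that] by force
    qed
    then have "Inf {L. joined G len x L z} - Inf {L. joined G len y L z} \<le> Inf {L. joined G len x L y}"
      by (intro cInf_greatest ne x y) (simp only: mem_Collect_eq, force)
    then show "path_dist G len x z \<le> path_dist G len x y + path_dist G len y z"
      using x y z by (simp add: path_dist_def)
  qed
qed

definition graph_topology ::
  "('v, 'e) pre_digraph \<Rightarrow> ('e \<Rightarrow> real) \<Rightarrow> ('v, 'e) gpoint topology" where
  "graph_topology G len = Metric_space.mtopology (points G len) (path_dist G len)"

text \<open>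
  \<open>(H, len)\<close> is a model of the metric space \<open>(M, d)\<close>, by means of the isometry \<open>\<phi>\<close>.
\<close>

definition is_model ::
  "('v, 'e) pre_digraph \<Rightarrow> ('e \<Rightarrow> real) \<Rightarrow> (('v, 'e) gpoint \<Rightarrow> 'p) \<Rightarrow>
    'p set \<Rightarrow> ('p \<Rightarrow> 'p \<Rightarrow> real) \<Rightarrow> bool" where
  "is_model H len \<phi> M d \<longleftrightarrow>
    fin_digraph H \<and> Digraph_Component.connected H \<and> (\<forall>e \<in> arcs H. 0 < len e) \<and>
    bij_betw \<phi> (points H len) M \<and>
    (\<forall>x \<in> points H len. \<forall>y \<in> points H len. d (\<phi> x) (\<phi> y) = path_dist H len x y)"

section \<open>Cycles and girth\<close>

text \<open>
  The geometric realisation of a graph is taken with all edge lengths equal to 1. A subgraph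
  homeomorphic to a circle is automatically connected; this is demanded separately since
  \<^const>\<open>path_dist\<close> is meaningless between different components.
\<close>

definition is_cycle :: "('v, 'e) pre_digraph \<Rightarrow> ('v, 'e) pre_digraph \<Rightarrow> bool" where
  "is_cycle G C \<longleftrightarrow> subgraph C G \<and> Digraph_Component.connected C \<and>
    graph_topology C (\<lambda>_. 1) homeomorphic_space top_of_set (sphere (0 :: complex) 1)"

definition girth :: "('v, 'e) pre_digraph \<Rightarrow> enat" where
  "girth G = (INF C \<in> {C. is_cycle G C}. enat (card (arcs C)))"

section \<open>Divisors and the Jacobian\<close>

definition Div :: "('v, 'e) pre_digraph \<Rightarrow> ('e \<Rightarrow> real) \<Rightarrow> (('v, 'e) gpoint \<Rightarrow>\<^sub>0 int) monoid" where
  "Div G len = free_Abelian_group (points G len)"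

definition div_degree :: "('p \<Rightarrow>\<^sub>0 int) \<Rightarrow> int" where
  "div_degree D = (\<Sum>x \<in> Poly_Mapping.keys D. Poly_Mapping.lookup D x)"

definition effective :: "('p \<Rightarrow>\<^sub>0 int) \<Rightarrow> bool" where
  "effective D \<longleftrightarrow> (\<forall>x. 0 \<le> Poly_Mapping.lookup D x)"

definition Div0 :: "('v, 'e) pre_digraph \<Rightarrow> ('e \<Rightarrow> real) \<Rightarrow> (('v, 'e) gpoint \<Rightarrow>\<^sub>0 int) monoid" where
  "Div0 G len = (Div G len)\<lparr>carrier := {D \<in> carrier (Div G len). div_degree D = 0}\<rparr>"

text \<open>
  Models have vertices and edges in \<^typ>\<open>nat\<close>, which is no restriction as they are finite.
\<close>

definition PL_Z :: "('v, 'e) pre_digraph \<Rightarrow> ('e \<Rightarrow> real) \<Rightarrow> (('v, 'e) gpoint \<Rightarrow> real) set" where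
  "PL_Z G len = {f. continuous_map (graph_topology G len) euclideanreal f \<and>
    (\<exists>(H :: (nat, nat) pre_digraph) len' \<phi>.
      is_model H len' \<phi> (points G len) (path_dist G len) \<and>
      (\<forall>e \<in> arcs H. \<exists>(a :: int) (b :: real). \<forall>t \<in> {0..len' e}.
        f (\<phi> (edge_point H len' e t)) = of_int a * t + b))}"

text \<open>
  The sum of the outgoing slopes at \<open>x\<close>. Each pair \<open>(e, t)\<close> with \<open>edge_point G len e t = x\<close>
  contributes an outgoing direction towards the head of \<open>e\<close> if \<open>t < len e\<close>, and one towards the
  tail if \<open>0 < t\<close>; hence a loop contributes two directions at its vertex, as does an edge at
  each of its inner points.
\<close>

definition slope_sum ::
  "('v, 'e) pre_digraph \<Rightarrow> ('e \<Rightarrow> real) \<Rightarrow> (('v, 'e) gpoint \<Rightarrow> real) \<Rightarrow> ('v, 'e) gpoint \<Rightarrow> real" where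
  "slope_sum G len f x =
    (\<Sum>(e, t) \<in> {(e, t). e \<in> arcs G \<and> 0 \<le> t \<and> t < len e \<and> edge_point G len e t = x}.
      vector_derivative (\<lambda>s. f (edge_point G len e s)) (at_right t)) +
    (\<Sum>(e, t) \<in> {(e, t). e \<in> arcs G \<and> 0 < t \<and> t \<le> len e \<and> edge_point G len e t = x}.
      - vector_derivative (\<lambda>s. f (edge_point G len e s)) (at_left t))"

text \<open>For \<open>f\<close> in \<open>PL_Z G len\<close> the sums of slopes are integers, so the floor is exact.\<close>

definition laplacian ::
  "('v, 'e) pre_digraph \<Rightarrow> ('e \<Rightarrow> real) \<Rightarrow> (('v, 'e) gpoint \<Rightarrow> real) \<Rightarrow> (('v, 'e) gpoint \<Rightarrow>\<^sub>0 int)" where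
  "laplacian G len f =
    - (\<Sum>x \<in> {x \<in> points G len. slope_sum G len f x \<noteq> 0}.
        frag_cmul \<lfloor>slope_sum G len f x\<rfloor> (frag_of x))"

definition principal ::
  "('v, 'e) pre_digraph \<Rightarrow> ('e \<Rightarrow> real) \<Rightarrow> (('v, 'e) gpoint \<Rightarrow>\<^sub>0 int) set" where
  "principal G len = laplacian G len ` PL_Z G len"

definition Jac ::
  "('v, 'e) pre_digraph \<Rightarrow> ('e \<Rightarrow> real) \<Rightarrow> (('v, 'e) gpoint \<Rightarrow>\<^sub>0 int) set monoid" where
  "Jac G len = Div0 G len Mod principal G len"

definition torsion :: "('a, 'b) monoid_scheme \<Rightarrow> 'a set" where
  "torsion A = {x \<in> carrier A. \<exists>n :: nat. 0 < n \<and> x [^]\<^bsub>A\<^esub> n = \<one>\<^bsub>A\<^esub>}"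

section \<open>The Manin--Mumford condition\<close>

definition abel_jacobi ::
  "('v, 'e) pre_digraph \<Rightarrow> ('e \<Rightarrow> real) \<Rightarrow> nat \<Rightarrow> (('v, 'e) gpoint \<Rightarrow>\<^sub>0 int) \<Rightarrow>
    (nat \<Rightarrow> ('v, 'e) gpoint) \<Rightarrow> (('v, 'e) gpoint \<Rightarrow>\<^sub>0 int) set" where
  "abel_jacobi G len d D p =
    principal G len #>\<^bsub>Div0 G len\<^esub> ((\<Sum>i<d. frag_of (p i)) - D)"

definition manin_mumford :: "('v, 'e) pre_digraph \<Rightarrow> ('e \<Rightarrow> real) \<Rightarrow> nat \<Rightarrow> bool" where
  "manin_mumford G len d \<longleftrightarrow>
    (\<forall>D \<in> carrier (Div G len). effective D \<and> div_degree D = int d \<longrightarrow>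
      finite (abel_jacobi G len d D ` ({..<d} \<rightarrow>\<^sub>E points G len) \<inter> torsion (Jac G len)))"

end

(*
  A cycle of G carries a flow z with values 1 and -1 on its edges. Move a chip along each edge of
  the support of z, in the direction of z, from the start of the edge to the fraction s of its
  length. The resulting sum of at most d points differs from the sum of the starts by s times
  the class of the cycle in H_1(Gamma, R) / H_1(Gamma, Z): it is torsion for s = 1/n, and different
  fractions in (0, 1) give different classes.
*)
theory Submission
  imports Defs
begin

text \<open>Two notions are given from outside the graph, and they shape the proof.
  \<open>PL_Z\<close> quantifies over all models, tied to the space only by an isometry, so
  membership must be turned into a condition on each edge of \<open>G\<close>
  (\<open>PL_Z_iff\<close>): an isometric curve locally runs along an edge, which carries linearity
  from any model to \<open>G\<close>, and conversely cutting the edges at the kinks yields a model.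
  A cycle is only known to be homeomorphic to a circle; the topological fact extracted is that none
  of its edges is a bridge, so an edge is closed up to a flow by a simple path around it. That
  different fractions give different classes is not read off from a description of the Jacobian as a
  real torus but from an energy estimate, and there it matters that the flow takes only the values
  0, 1 and -1: for an integer slope \<open>m\<close>, the product of \<open>m\<close> and
  \<open>m + z\<close> cannot be negative.\<close>

text \<open>Cutting at a point of \<open>B\<close> leaves strictly fewer points of \<open>B\<close>
  inside either half, so everything reduces to gaps of \<open>B\<close>. It serves to glue estimates
  across kinks and to lift segments across cut points.\<close>

lemma finite_split_induct:
  fixes B :: "real set"
  assumes "finite B" "s \<le> t"
    and gap: "\<And>s t. s \<le> t \<Longrightarrow> B \<inter> {s<..<t} = {} \<Longrightarrow> P s t"
    and join: "\<And>s b t. s < b \<Longrightarrow> b < t \<Longrightarrow> b \<in> B \<Longrightarrow> P s b \<Longrightarrow> P b t \<Longrightarrow> P s t"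
  shows "P s t"
  using assms(2)
proof (induction "card (B \<inter> {s<..<t})" arbitrary: s t rule: less_induct)
  case less
  show ?case
  proof (cases "B \<inter> {s<..<t} = {}")
    case False
    then obtain b where b: "b \<in> B" "s < b" "b < t" by auto
    have "card (B \<inter> {s<..<b}) < card (B \<inter> {s<..<t})" "card (B \<inter> {b<..<t}) < card (B \<inter> {s<..<t})"
      using b assms(1) by (auto intro!: psubset_card_mono)
    then show ?thesis using less b by (intro join[of s b t]) auto
  qed (use less gap in auto)
qed

section \<open>Piecewise linear functions of one variable\<close>

abbreviation rslope :: "(real \<Rightarrow> real) \<Rightarrow> real \<Rightarrow> real" where
  "rslope u t \<equiv> vector_derivative u (at_right t)"

abbreviation lslope :: "(real \<Rightarrow> real) \<Rightarrow> real \<Rightarrow> real" where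
  "lslope u t \<equiv> vector_derivative u (at_left t)"

text \<open>
  Piecewise linearity with integer slopes on \<open>[0, l]\<close> is expressed by one-sided germs;
  the finiteness of the set of break points follows by compactness.
\<close>

definition pl_on :: "real \<Rightarrow> (real \<Rightarrow> real) \<Rightarrow> bool" where
  "pl_on l u \<longleftrightarrow>
    (\<forall>t \<in> {0..<l}. \<exists>a \<in> \<int>. \<forall>\<^sub>F s in at_right t. u s = u t + a * (s - t)) \<and>
    (\<forall>t \<in> {0<..l}. \<exists>a \<in> \<int>. \<forall>\<^sub>F s in at_left t. u s = u t + a * (s - t))"

text \<open>The difference quotient is eventually constant. Since \<open>vector_derivative\<close>
  is a choice among all derivatives, its value is pinned down only because the filter is
  nontrivial.\<close>

lemma vector_derivative_affine_germ:
  fixes u :: "real \<Rightarrow> real"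
  assumes "at t within S \<noteq> bot" "\<forall>\<^sub>F s in at t within S. u s = u t + a * (s - t)"
  shows "vector_derivative u (at t within S) = a"
proof (rule vector_derivative_within[OF assms(1)])
  have "\<forall>\<^sub>F s in at t within S. (u s - u t) / (s - t) = a"
    using assms(2) unfolding eventually_at_filter by eventually_elim auto
  then have "((\<lambda>s. (u s - u t) / (s - t)) \<longlongrightarrow> a) (at t within S)"
    by (rule tendsto_eventually)
  then show "(u has_vector_derivative a) (at t within S)"
    by (simp add: has_field_derivative_iff flip: has_real_derivative_iff_has_vector_derivative)
qed

lemmas rslope_eqI = vector_derivative_affine_germ[OF trivial_limit_at_right_real]
lemmas lslope_eqI = vector_derivative_affine_germ[OF trivial_limit_at_left_real]

lemma pl_on_right:
  assumes "pl_on l u" "0 \<le> t" "t < l"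
  shows "rslope u t \<in> \<int>" "\<forall>\<^sub>F s in at_right t. u s = u t + rslope u t * (s - t)"
proof -
  obtain a where a: "a \<in> \<int>" "\<forall>\<^sub>F s in at_right t. u s = u t + a * (s - t)"
    using assms unfolding pl_on_def by (meson atLeastLessThan_iff)
  show "rslope u t \<in> \<int>" "\<forall>\<^sub>F s in at_right t. u s = u t + rslope u t * (s - t)"
    using a rslope_eqI[OF a(2)] by auto
qed

lemma pl_on_left:
  assumes "pl_on l u" "0 < t" "t \<le> l"
  shows "lslope u t \<in> \<int>" "\<forall>\<^sub>F s in at_left t. u s = u t + lslope u t * (s - t)"
proof -
  obtain a where a: "a \<in> \<int>" "\<forall>\<^sub>F s in at_left t. u s = u t + a * (s - t)"
    using assms unfolding pl_on_def by (meson greaterThanAtMost_iff)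
  show "lslope u t \<in> \<int>" "\<forall>\<^sub>F s in at_left t. u s = u t + lslope u t * (s - t)"
    using a lslope_eqI[OF a(2)] by auto
qed

lemma pl_onI:
  assumes "\<And>t. 0 \<le> t \<Longrightarrow> t < l \<Longrightarrow> \<exists>a \<in> \<int>. \<forall>\<^sub>F s in at_right t. u s = u t + a * (s - t)"
    and "\<And>t. 0 < t \<Longrightarrow> t \<le> l \<Longrightarrow> \<exists>a \<in> \<int>. \<forall>\<^sub>F s in at_left t. u s = u t + a * (s - t)"
  shows "pl_on l u"
  using assms unfolding pl_on_def by auto

lemma affine_germ_lincomb:
  fixes u v :: "real \<Rightarrow> real"
  assumes "\<forall>\<^sub>F s in F. u s = u t + a * (s - t)" "\<forall>\<^sub>F s in F. v s = v t + b * (s - t)"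
  shows "\<forall>\<^sub>F s in F. u s + c * v s = u t + c * v t + (a + c * b) * (s - t)"
  using assms
proof eventually_elim
  case (elim s)
  then show ?case by (simp only: elim) (simp add: algebra_simps)
qed

lemma rslope_lincomb:
  assumes "pl_on l u" "pl_on l v" "0 \<le> t" "t < l"
  shows "rslope (\<lambda>s. u s + c * v s) t = rslope u t + c * rslope v t"
  using pl_on_right(2)[OF assms(1,3,4)] pl_on_right(2)[OF assms(2,3,4)]
  by (intro rslope_eqI affine_germ_lincomb)

lemma lslope_lincomb:
  assumes "pl_on l u" "pl_on l v" "0 < t" "t \<le> l"
  shows "lslope (\<lambda>s. u s + c * v s) t = lslope u t + c * lslope v t"
  using pl_on_left(2)[OF assms(1,3,4)] pl_on_left(2)[OF assms(2,3,4)]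
  by (intro lslope_eqI affine_germ_lincomb)

lemma pl_on_lincomb:
  assumes "pl_on l u" "pl_on l v" "c \<in> \<int>"
  shows "pl_on l (\<lambda>s. u s + c * v s)"
proof (rule pl_onI)
  fix t assume t: "0 \<le> t" "t < l"
  show "\<exists>a\<in>\<int>. \<forall>\<^sub>F s in at_right t. u s + c * v s = u t + c * v t + a * (s - t)"
    using pl_on_right[OF assms(1) t] pl_on_right[OF assms(2) t] assms(3)
    by (intro bexI[of _ "rslope u t + c * rslope v t"] affine_germ_lincomb) auto
next
  fix t assume t: "0 < t" "t \<le> l"
  show "\<exists>a\<in>\<int>. \<forall>\<^sub>F s in at_left t. u s + c * v s = u t + c * v t + a * (s - t)"
    using pl_on_left[OF assms(1) t] pl_on_left[OF assms(2) t] assms(3)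
    by (intro bexI[of _ "lslope u t + c * lslope v t"] affine_germ_lincomb) auto
qed

lemma rslope_cong:
  assumes "x < d" "\<And>s. x \<le> s \<Longrightarrow> s < d \<Longrightarrow> u s = k + a * s"
  shows "rslope u x = a"
proof (rule rslope_eqI)
  show "\<forall>\<^sub>F s in at_right x. u s = u x + a * (s - x)"
    unfolding eventually_at_right_field using assms by (intro exI[of _ d]) (auto simp: algebra_simps)
qed

lemma lslope_cong:
  assumes "d < x" "\<And>s. d < s \<Longrightarrow> s \<le> x \<Longrightarrow> u s = k + a * s"
  shows "lslope u x = a"
proof (rule lslope_eqI)
  show "\<forall>\<^sub>F s in at_left x. u s = u x + a * (s - x)"
    unfolding eventually_at_left_field using assms by (intro exI[of _ d]) (auto simp: algebra_simps)
qed

text \<open>The germ at \<open>t\<close> fixes both slopes at every nearby point to its right, so no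
  kink can be close to \<open>t\<close> on that side.\<close>

lemma right_germ_slopes:
  assumes "\<forall>\<^sub>F s in at_right t. u s = u t + a * (s - t)"
  obtains d where "t < d" "\<And>x. t < x \<Longrightarrow> x < d \<Longrightarrow> u x = u t + a * (x - t)"
    "\<And>x. t < x \<Longrightarrow> x < d \<Longrightarrow> rslope u x = a" "\<And>x. t < x \<Longrightarrow> x < d \<Longrightarrow> lslope u x = a"
proof -
  obtain d where d: "t < d" "\<And>x. t < x \<Longrightarrow> x < d \<Longrightarrow> u x = u t + a * (x - t)"
    using assms unfolding eventually_at_right_field by auto
  have "rslope u x = a" if "t < x" "x < d" for x
    using that d(2) by (intro rslope_cong[of x d u "u t - a * t"]) (auto simp: algebra_simps)
  moreover have "lslope u x = a" if "t < x" "x < d" for x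
    using that d(2) by (intro lslope_cong[of t x u "u t - a * t"]) (auto simp: algebra_simps)
  ultimately show ?thesis using d that by blast
qed

lemma left_germ_slopes:
  assumes "\<forall>\<^sub>F s in at_left t. u s = u t + a * (s - t)"
  obtains d where "d < t" "\<And>x. d < x \<Longrightarrow> x < t \<Longrightarrow> u x = u t + a * (x - t)"
    "\<And>x. d < x \<Longrightarrow> x < t \<Longrightarrow> rslope u x = a" "\<And>x. d < x \<Longrightarrow> x < t \<Longrightarrow> lslope u x = a"
proof -
  obtain d where d: "d < t" "\<And>x. d < x \<Longrightarrow> x < t \<Longrightarrow> u x = u t + a * (x - t)"
    using assms unfolding eventually_at_left_field by auto
  have "rslope u x = a" if "d < x" "x < t" for x
    using that d(2) by (intro rslope_cong[of x t u "u t - a * t"]) (auto simp: algebra_simps)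
  moreover have "lslope u x = a" if "d < x" "x < t" for x
    using that d(2) by (intro lslope_cong[of d x u "u t - a * t"]) (auto simp: algebra_simps)
  ultimately show ?thesis using d that by blast
qed

section \<open>Kinks, affine pieces and Lipschitz bounds\<close>

text \<open>Infinitely many kinks would accumulate in the compact interval, but the germs at an
  accumulation point keep both of its sides free of kinks.\<close>

lemma finite_kinks:
  assumes "pl_on l u"
  shows "finite {t \<in> {0<..<l}. rslope u t \<noteq> lslope u t}" (is "finite ?S")
proof (rule ccontr)
  assume "infinite ?S"
  moreover have "?S \<subseteq> {0..l}" by auto
  ultimately obtain x where x: "x \<in> {0..l}" "x islimpt ?S"
    using Heine_Borel_imp_Bolzano_Weierstrass[OF compact_Icc] by blast
  obtain d where d: "x < d" "\<And>y. x < y \<Longrightarrow> y < d \<Longrightarrow> y \<notin> ?S"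
  proof (cases "x < l")
    case True
    then obtain d where "x < d" "\<And>y. x < y \<Longrightarrow> y < d \<Longrightarrow> rslope u y = rslope u x"
      "\<And>y. x < y \<Longrightarrow> y < d \<Longrightarrow> lslope u y = rslope u x"
      using right_germ_slopes[OF pl_on_right(2)[OF assms, of x]] x(1) by (metis atLeastAtMost_iff)
    then show ?thesis by (intro that[of d]) simp_all
  next
    case False
    \<comment> \<open>Right of \<open>l\<close> there are no kinks by definition, so any
      \<open>d\<close> will do.\<close>
    then show ?thesis using that[of "x + 1"] by auto
  qed
  obtain c where c: "c < x" "\<And>y. c < y \<Longrightarrow> y < x \<Longrightarrow> y \<notin> ?S"
  proof (cases "0 < x")
    case True
    then obtain c where "c < x" "\<And>y. c < y \<Longrightarrow> y < x \<Longrightarrow> rslope u y = lslope u x"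
      "\<And>y. c < y \<Longrightarrow> y < x \<Longrightarrow> lslope u y = lslope u x"
      using left_germ_slopes[OF pl_on_left(2)[OF assms, of x]] x(1) by (metis atLeastAtMost_iff)
    then show ?thesis by (intro that[of c]) simp_all
  next
    case False
    then show ?thesis using that[of "x - 1"] by auto
  qed
  have "x \<in> {c<..<d}" using c d by auto
  then obtain y where "y \<in> ?S" "y \<in> {c<..<d}" "y \<noteq> x"
    by (rule islimptE[OF x(2) _ open_greaterThanLessThan])
  then show False using c(2)[of y] d(2)[of y] by (cases "x < y") auto
qed

text \<open>Slope and intercept of the germ at \<open>t\<close>, the pair \<open>F t\<close>, are
  locally constant where there is no kink, hence constant on the connected open interval. The end
  points are reached through their own germs.\<close>

lemma pl_on_affine:
  assumes u: "pl_on l u" and ab: "0 \<le> a" "a < b" "b \<le> l"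
    and no_kink: "\<And>t. a < t \<Longrightarrow> t < b \<Longrightarrow> rslope u t = lslope u t"
  shows "\<And>t. a \<le> t \<Longrightarrow> t \<le> b \<Longrightarrow> u t = u a + rslope u a * (t - a)" "lslope u b = rslope u a"
proof -
  define F where "F = (\<lambda>t. (rslope u t, u t - rslope u t * t))"
  have local: "\<forall>\<^sub>F s in at t within {a<..<b}. F t = F s" if "t \<in> {a<..<b}" for t
  proof -
    have t: "0 \<le> t" "t < l" "0 < t" "t \<le> l" using that ab by auto
    obtain d where d: "t < d" "\<And>x. t < x \<Longrightarrow> x < d \<Longrightarrow> u x = u t + rslope u t * (x - t)"
      "\<And>x. t < x \<Longrightarrow> x < d \<Longrightarrow> rslope u x = rslope u t"
      using right_germ_slopes[OF pl_on_right(2)[OF u t(1,2)]] by metis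
    have "rslope u t = lslope u t" using no_kink that by auto
    then obtain c where c: "c < t" "\<And>x. c < x \<Longrightarrow> x < t \<Longrightarrow> u x = u t + rslope u t * (x - t)"
      "\<And>x. c < x \<Longrightarrow> x < t \<Longrightarrow> rslope u x = rslope u t"
      using left_germ_slopes[OF pl_on_left(2)[OF u t(3,4)]] by metis
    have "F t = F s" if "s \<in> {c<..<d}" for s
      using that c(2,3)[of s] d(2,3)[of s] unfolding F_def
      by (cases s t rule: linorder_cases) (auto simp: algebra_simps)
    moreover have "\<forall>\<^sub>F s in at t within {a<..<b}. s \<in> {c<..<d}"
      using c(1) d(1) by (intro topological_tendstoD[OF tendsto_ident_at]) auto
    ultimately show ?thesis by (auto elim: eventually_mono)
  qed
  have const: "F s = F t" if "s \<in> {a<..<b}" "t \<in> {a<..<b}" for s t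
    using local that by (intro connected_local_const[of "{a<..<b}"] connected_Ioo ballI)
  obtain c k where ck: "\<And>t. t \<in> {a<..<b} \<Longrightarrow> u t = c * t + k"
  proof (rule that)
    fix t assume "t \<in> {a<..<b}"
    then have "F t = F ((a + b) / 2)" using ab(2) by (intro const) auto
    moreover have "u t = fst (F t) * t + snd (F t)" by (simp add: F_def)
    ultimately show "u t = fst (F ((a + b) / 2)) * t + snd (F ((a + b) / 2))" by simp
  qed
  \<comment> \<open>An affine function is determined by its values on a nonempty open interval. This
    compares the line found inside with the germs at \<open>a\<close> and \<open>b\<close>.\<close>
  have two: "c = p \<and> k = q - p * x"
    if yz: "y < z" and eq: "\<And>s. s \<in> {y<..<z} \<Longrightarrow> c * s + k = q + p * (s - x)" for p q x y z :: real
  proof -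
    obtain s1 where s1: "y < s1" "s1 < z" using dense[OF yz] by auto
    obtain s2 where s2: "s1 < s2" "s2 < z" using dense[OF s1(2)] by auto
    have s: "s1 \<in> {y<..<z}" "s2 \<in> {y<..<z}" "s1 < s2" using s1 s2 by auto
    have "(c - p) * (s1 - s2) = 0" using eq[OF s(1)] eq[OF s(2)] by (simp add: algebra_simps)
    then have "c = p" using s(3) by simp
    moreover have "k = q - p * x" using eq[OF s(1)] unfolding \<open>c = p\<close> by (simp add: algebra_simps)
    ultimately show ?thesis by simp
  qed
  obtain d where d: "a < d" "\<And>x. a < x \<Longrightarrow> x < d \<Longrightarrow> u x = u a + rslope u a * (x - a)"
    using right_germ_slopes[OF pl_on_right(2)[OF u, of a]] ab by (metis order_less_le_trans)
  have A: "c = rslope u a \<and> k = u a - rslope u a * a"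
  proof (rule two[of a "min b d"])
    show "c * s + k = u a + rslope u a * (s - a)" if "s \<in> {a<..<min b d}" for s
      using d(2)[of s] ck[of s] that by auto
  qed (use d ab in auto)
  obtain e where e: "e < b" "\<And>x. e < x \<Longrightarrow> x < b \<Longrightarrow> u x = u b + lslope u b * (x - b)"
    using left_germ_slopes[OF pl_on_left(2)[OF u, of b]] ab by (metis order_le_less_trans)
  have B: "c = lslope u b \<and> k = u b - lslope u b * b"
  proof (rule two[of "max a e" b])
    show "c * s + k = u b + lslope u b * (s - b)" if "s \<in> {max a e<..<b}" for s
      using e(2)[of s] ck[of s] that by auto
  qed (use e ab in auto)
  show "lslope u b = rslope u a" using A B by auto
  fix t assume "a \<le> t" "t \<le> b"
  then consider "t = a" | "t = b" | "t \<in> {a<..<b}" by force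
  then show "u t = u a + rslope u a * (t - a)"
  proof cases
    case 2
    then show ?thesis using A B by (simp add: algebra_simps)
  qed (use A ck[of t] in \<open>auto simp: algebra_simps\<close>)
qed

lemma pl_on_lipschitz:
  assumes u: "pl_on l u" and "0 \<le> l"
  shows "\<exists>K \<ge> 0. \<forall>x \<in> {0..l}. \<forall>y \<in> {0..l}. \<bar>u x - u y\<bar> \<le> K * \<bar>x - y\<bar>"
proof -
  \<comment> \<open>The induction ranges over all real intervals, so the bounds
    \<open>0 \<le> s\<close> and \<open>t \<le> l\<close> travel as premises inside
    \<open>P\<close>.\<close>
  define P where "P = (\<lambda>s t. 0 \<le> s \<longrightarrow> t \<le> l \<longrightarrow>
    (\<exists>K \<ge> 0. \<forall>x \<in> {s..t}. \<forall>y \<in> {s..t}. \<bar>u x - u y\<bar> \<le> K * \<bar>x - y\<bar>))"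
  have "P 0 l"
  proof (rule finite_split_induct[where P = P, OF finite_kinks[OF u] assms(2)])
    fix s t :: real
    assume st: "s \<le> t" "{t \<in> {0<..<l}. rslope u t \<noteq> lslope u t} \<inter> {s<..<t} = {}"
    show "P s t" unfolding P_def
    proof (intro impI exI[of _ "\<bar>rslope u s\<bar>"] conjI ballI)
      fix x y assume *: "0 \<le> s" "t \<le> l" and xy: "x \<in> {s..t}" "y \<in> {s..t}"
      show "\<bar>u x - u y\<bar> \<le> \<bar>rslope u s\<bar> * \<bar>x - y\<bar>"
      proof (cases "s = t")
        case False
        have "u z = u s + rslope u s * (z - s)" if "z \<in> {s..t}" for z
        proof (intro pl_on_affine(1)[OF u, of s t])
          fix r assume "s < r" "r < t"
          then have "r \<in> {0<..<l}" "r \<in> {s<..<t}" using * by auto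
          then show "rslope u r = lslope u r" using st(2) by blast
        qed (use that st * False in auto)
        from this[OF xy(1)] this[OF xy(2)] have "u x - u y = rslope u s * (x - y)"
          by (simp add: algebra_simps)
        then show ?thesis by (simp add: abs_mult)
      qed (use xy in auto)
    qed auto
  next
    fix s b t assume b: "s < b" "b < t" and P: "P s b" "P b t"
    show "P s t" unfolding P_def
    proof (intro impI)
      assume *: "0 \<le> s" "t \<le> l"
      obtain K1 where K1: "K1 \<ge> 0" "\<And>x y. x \<in> {s..b} \<Longrightarrow> y \<in> {s..b} \<Longrightarrow> \<bar>u x - u y\<bar> \<le> K1 * \<bar>x - y\<bar>"
        using P(1) * b unfolding P_def by auto
      obtain K2 where K2: "K2 \<ge> 0" "\<And>x y. x \<in> {b..t} \<Longrightarrow> y \<in> {b..t} \<Longrightarrow> \<bar>u x - u y\<bar> \<le> K2 * \<bar>x - y\<bar>"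
        using P(2) * b unfolding P_def by auto
      define K where "K = K1 + K2"
      have K1': "\<bar>u x - u y\<bar> \<le> K * \<bar>x - y\<bar>" if "x \<in> {s..b}" "y \<in> {s..b}" for x y
        using K1(2)[OF that] K2(1) unfolding K_def by (simp add: distrib_right add_increasing2)
      have K2': "\<bar>u x - u y\<bar> \<le> K * \<bar>x - y\<bar>" if "x \<in> {b..t}" "y \<in> {b..t}" for x y
        using K2(2)[OF that] K1(1) unfolding K_def by (simp add: distrib_right add_increasing)
      have mix: "\<bar>u x - u y\<bar> \<le> K * \<bar>x - y\<bar>" if "x \<in> {s..b}" "y \<in> {b..t}" for x y
      proof -
        have "K * \<bar>x - b\<bar> + K * \<bar>b - y\<bar> = K * \<bar>x - y\<bar>"
          using that by (simp add: abs_if algebra_simps)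
        then show ?thesis using K1'[of x b] K2'[of b y] that by auto
      qed
      have "\<bar>u x - u y\<bar> \<le> K * \<bar>x - y\<bar>" if "x \<in> {s..t}" "y \<in> {s..t}" for x y
        using K1'[of x y] K2'[of x y] mix[of x y] mix[of y x] that
        by (cases "x \<le> b"; cases "y \<le> b") (auto simp: abs_minus_commute)
      then show "\<exists>K\<ge>0. \<forall>x\<in>{s..t}. \<forall>y\<in>{s..t}. \<bar>u x - u y\<bar> \<le> K * \<bar>x - y\<bar>"
        using K1(1) K2(1) by (intro exI[of _ K]) (auto simp: K_def)
    qed
  qed
  then show ?thesis using assms(2) unfolding P_def by auto
qed

section \<open>Functions with prescribed slopes\<close>

text \<open>Each piece contains its base point \<open>t\<close>, so its formula also fixes
  \<open>u t\<close> and becomes a germ there; the guessed slopes \<open>r\<close> and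
  \<open>q\<close> are thereby confirmed.\<close>

lemma pl_on_pieces:
  assumes right: "\<And>t. 0 \<le> t \<Longrightarrow> t < l \<Longrightarrow> r t \<in> \<int> \<and> (\<exists>d > t. \<exists>k. \<forall>s. t \<le> s \<and> s < d \<longrightarrow> u s = k + r t * s)"
    and left: "\<And>t. 0 < t \<Longrightarrow> t \<le> l \<Longrightarrow> q t \<in> \<int> \<and> (\<exists>d < t. \<exists>k. \<forall>s. d < s \<and> s \<le> t \<longrightarrow> u s = k + q t * s)"
  shows "pl_on l u" "\<And>t. 0 \<le> t \<Longrightarrow> t < l \<Longrightarrow> rslope u t = r t"
    "\<And>t. 0 < t \<Longrightarrow> t \<le> l \<Longrightarrow> lslope u t = q t"
proof -
  have R: "r t \<in> \<int>" "\<forall>\<^sub>F s in at_right t. u s = u t + r t * (s - t)" if t: "0 \<le> t" "t < l" for t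
  proof -
    obtain d k where "t < d" "\<And>s. t \<le> s \<Longrightarrow> s < d \<Longrightarrow> u s = k + r t * s"
      using right[OF t] by blast
    then show "\<forall>\<^sub>F s in at_right t. u s = u t + r t * (s - t)"
      unfolding eventually_at_right_field by (intro exI[of _ d]) (auto simp: algebra_simps)
  qed (use right t in blast)
  have L: "q t \<in> \<int>" "\<forall>\<^sub>F s in at_left t. u s = u t + q t * (s - t)" if t: "0 < t" "t \<le> l" for t
  proof -
    obtain d k where "d < t" "\<And>s. d < s \<Longrightarrow> s \<le> t \<Longrightarrow> u s = k + q t * s"
      using left[OF t] by blast
    then show "\<forall>\<^sub>F s in at_left t. u s = u t + q t * (s - t)"
      unfolding eventually_at_left_field by (intro exI[of _ d]) (auto simp: algebra_simps)
  qed (use left t in blast)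
  show "pl_on l u" using R L by (intro pl_onI) blast+
  show "rslope u t = r t" if "0 \<le> t" "t < l" for t by (rule rslope_eqI[OF R(2)[OF that]])
  show "lslope u t = q t" if "0 < t" "t \<le> l" for t by (rule lslope_eqI[OF L(2)[OF that]])
qed

text \<open>The slope of the ramp changes only at \<open>a\<close> and \<open>b\<close>; a multiple
  of it will absorb the two kinks that a pair of chips causes on an edge.\<close>

lemma pl_on_ramp:
  fixes a b l :: real
  defines "u \<equiv> \<lambda>t. min (max t a) b"
  assumes "a < b"
  shows "pl_on l u" "\<And>t. 0 \<le> t \<Longrightarrow> t < l \<Longrightarrow> rslope u t = (if a \<le> t \<and> t < b then 1 else 0)"
    "\<And>t. 0 < t \<Longrightarrow> t \<le> l \<Longrightarrow> lslope u t = (if a < t \<and> t \<le> b then 1 else 0)"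
proof -
  have R: "\<exists>d > t. \<exists>k. \<forall>s. t \<le> s \<and> s < d \<longrightarrow> u s = k + (if a \<le> t \<and> t < b then 1 else 0) * s" for t
  proof -
    consider "t < a" | "a \<le> t" "t < b" | "b \<le> t" using assms(2) by linarith
    then show ?thesis
    proof cases
      case 1
      then show ?thesis using assms(2) by (intro exI[of _ a] conjI exI[of _ a]) (auto simp: u_def)
    next
      case 2
      then show ?thesis using assms(2) by (intro exI[of _ b] conjI exI[of _ 0]) (auto simp: u_def)
    next
      case 3
      then show ?thesis using assms(2) by (intro exI[of _ "t + 1"] conjI exI[of _ b]) (auto simp: u_def)
    qed
  qed
  have L: "\<exists>d < t. \<exists>k. \<forall>s. d < s \<and> s \<le> t \<longrightarrow> u s = k + (if a < t \<and> t \<le> b then 1 else 0) * s" for t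
  proof -
    consider "t \<le> a" | "a < t" "t \<le> b" | "b < t" using assms(2) by linarith
    then show ?thesis
    proof cases
      case 1
      then show ?thesis using assms(2) by (intro exI[of _ "t - 1"] conjI exI[of _ a]) (auto simp: u_def)
    next
      case 2
      then show ?thesis using assms(2) by (intro exI[of _ a] conjI exI[of _ 0]) (auto simp: u_def)
    next
      case 3
      then show ?thesis using assms(2) by (intro exI[of _ b] conjI exI[of _ b]) (auto simp: u_def)
    qed
  qed
  note pieces = pl_on_pieces[where r = "\<lambda>t. if a \<le> t \<and> t < b then 1 else 0" and
      q = "\<lambda>t. if a < t \<and> t \<le> b then 1 else 0" and u = u and l = l]
  show "pl_on l u" by (rule pieces) (use R L in auto)
  show "rslope u t = (if a \<le> t \<and> t < b then 1 else 0)" if "0 \<le> t" "t < l" for t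
    by (rule pieces(2)) (use R L that in auto)
  show "lslope u t = (if a < t \<and> t \<le> b then 1 else 0)" if "0 < t" "t \<le> l" for t
    by (rule pieces(3)) (use R L that in auto)
qed

text \<open>\<open>c\<close> is where the two lines cross, since the assumption says
  \<open>\<alpha> * c = \<beta> * (l - c)\<close>. The formula for \<open>u\<close> is asked only on
  \<open>[0, l]\<close>: beyond the ends of the edge, a function read through
  \<open>edge_point\<close> is constant.\<close>

lemma pl_on_tent:
  fixes \<alpha> \<beta> l c :: real
  assumes "0 < \<alpha>" "0 < \<beta>" "\<alpha> \<in> \<int>" "\<beta> \<in> \<int>" "0 < l" and c: "(\<alpha> + \<beta>) * c = \<beta> * l"
    and u: "\<And>t. 0 \<le> t \<Longrightarrow> t \<le> l \<Longrightarrow> u t = min (\<alpha> * t) (\<beta> * (l - t))"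
  shows "pl_on l u" "\<And>t. 0 \<le> t \<Longrightarrow> t < l \<Longrightarrow> rslope u t = (if t < c then \<alpha> else - \<beta>)"
    "\<And>t. 0 < t \<Longrightarrow> t \<le> l \<Longrightarrow> lslope u t = (if t \<le> c then \<alpha> else - \<beta>)"
proof -
  have "0 < (\<alpha> + \<beta>) * c" unfolding c using assms by simp
  then have "0 < c" by (rule zero_less_mult_pos) (use assms in simp)
  have "(\<alpha> + \<beta>) * c < (\<alpha> + \<beta>) * l" unfolding c using assms by simp
  then have "c < l" using assms(1,2) mult_less_cancel_left_pos[of "\<alpha> + \<beta>" c l] by simp
  have up: "u s = \<alpha> * s" if "0 \<le> s" "s \<le> c" for s
  proof -
    have "(\<alpha> + \<beta>) * s \<le> \<beta> * l"
      unfolding c[symmetric] using assms(1,2) that by (intro mult_left_mono) auto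
    then show ?thesis using u[of s] that \<open>c < l\<close> by (simp add: algebra_simps)
  qed
  have down: "u s = \<beta> * l + - \<beta> * s" if "c \<le> s" "s \<le> l" for s
  proof -
    have "\<beta> * l \<le> (\<alpha> + \<beta>) * s"
      unfolding c[symmetric] using assms(1,2) that by (intro mult_left_mono) auto
    then show ?thesis using u[of s] that \<open>0 < c\<close> by (simp add: algebra_simps)
  qed
  have R: "\<exists>d > t. \<exists>k. \<forall>s. t \<le> s \<and> s < d \<longrightarrow> u s = k + (if t < c then \<alpha> else - \<beta>) * s"
    if "0 \<le> t" "t < l" for t
  proof (cases "t < c")
    case True
    then show ?thesis using up that by (intro exI[of _ c] conjI exI[of _ 0]) auto
  next
    case False
    then show ?thesis using down that by (intro exI[of _ l] conjI exI[of _ "\<beta> * l"]) auto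
  qed
  have L: "\<exists>d < t. \<exists>k. \<forall>s. d < s \<and> s \<le> t \<longrightarrow> u s = k + (if t \<le> c then \<alpha> else - \<beta>) * s"
    if "0 < t" "t \<le> l" for t
  proof (cases "t \<le> c")
    case True
    then show ?thesis using up that by (intro exI[of _ 0] conjI exI[of _ 0]) auto
  next
    case False
    then show ?thesis using down that by (intro exI[of _ c] conjI exI[of _ "\<beta> * l"]) auto
  qed
  note pieces = pl_on_pieces[where r = "\<lambda>t. if t < c then \<alpha> else - \<beta>" and
      q = "\<lambda>t. if t \<le> c then \<alpha> else - \<beta>" and u = u and l = l]
  show "pl_on l u" by (rule pieces) (use R L assms(3,4) in auto)
  show "rslope u t = (if t < c then \<alpha> else - \<beta>)" if "0 \<le> t" "t < l" for t
    by (rule pieces(2)) (use R L assms(3,4) that in auto)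
  show "lslope u t = (if t \<le> c then \<alpha> else - \<beta>)" if "0 < t" "t \<le> l" for t
    by (rule pieces(3)) (use R L assms(3,4) that in auto)
qed

section \<open>Local structure of a metric graph\<close>

locale metric_graph =
  fixes G :: "('v, 'e) pre_digraph" and len :: "'e \<Rightarrow> real"
  assumes fin: "fin_digraph G"
    and conn: "Digraph_Component.connected G"
    and len_pos: "e \<in> arcs G \<Longrightarrow> 0 < len e"
begin

abbreviation ep :: "'e \<Rightarrow> real \<Rightarrow> ('v, 'e) gpoint" where
  "ep \<equiv> edge_point G len"

lemma wf: "wf_digraph G"
  using fin by (simp add: fin_digraph_def)

lemma finite_arcs: "finite (arcs G)" and finite_verts: "finite (verts G)"
  using fin by (auto simp: fin_digraph.finite_arcs fin_digraph.finite_verts)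

lemma metric: "Metric_space (points G len) (path_dist G len)"
  using Metric_space_path_dist[OF fin conn] len_pos by blast

lemma ep_in_points: "e \<in> arcs G \<Longrightarrow> ep e t \<in> points G len"
  by (rule edge_point_in_points[OF wf])

lemma ep_inner: "0 < t \<Longrightarrow> t < len e \<Longrightarrow> ep e t = Inner e t"
  by (simp add: edge_point_def)

lemma ep_inj:
  assumes "0 < t" "t < len e" "ep e t = ep e' t'"
  shows "e' = e \<and> t' = t"
  using assms by (auto simp: edge_point_def split: if_splits)

lemma joined_ex_points:
  assumes "x \<in> points G len" "y \<in> points G len"
  shows "{L. joined G len x L y} \<noteq> {}"
  using joined_ex[OF wf conn _ assms] len_pos by auto

lemma path_dist_le:
  assumes "joined G len x L y"
  shows "path_dist G len x y \<le> L"
proof -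
  have "bdd_below {L. joined G len x L y}"
    using joined_points[OF wf] by (intro bdd_belowI[of _ 0]) blast
  then show ?thesis
    using joined_points[OF wf assms] assms by (auto simp: path_dist_def intro!: cInf_lower)
qed

lemma path_dist_less:
  assumes "x \<in> points G len" "y \<in> points G len" "path_dist G len x y < K"
  obtains L where "joined G len x L y" "L < K"
  using cInf_lessD[OF joined_ex_points[OF assms(1,2)], of K] assms by (auto simp: path_dist_def)

lemma path_dist_ge:
  assumes "x \<in> points G len" "y \<in> points G len" "\<And>L. joined G len x L y \<Longrightarrow> K \<le> L"
  shows "K \<le> path_dist G len x y"
  using cInf_greatest[OF joined_ex_points[OF assms(1,2)], of K] assms by (auto simp: path_dist_def)

text \<open>The ball of radius \<open>r\<close> at \<open>y\<close> contains no vertex except possibly \<open>y\<close>.\<close>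

definition star_radius :: "('v, 'e) gpoint \<Rightarrow> real \<Rightarrow> bool" where
  "star_radius y r \<longleftrightarrow> 0 < r \<and> (\<forall>e \<in> arcs G. \<forall>t \<in> {0..len e}. ep e t = y \<longrightarrow>
    (t = 0 \<or> r \<le> t) \<and> (t = len e \<or> r \<le> len e - t))"

lemma star_radius_ex:
  assumes "y \<in> points G len"
  obtains r where "star_radius y r"
  using assms
proof (cases rule: points_cases)
  case (1 v)
  \<comment> \<open>The shortest edge length, or less; 1 is inserted for a graph without
    edges.\<close>
  define r where "r = Min (insert 1 (len ` arcs G))"
  have r: "0 < r" "\<And>e. e \<in> arcs G \<Longrightarrow> r \<le> len e"
    unfolding r_def using finite_arcs len_pos by auto
  have "star_radius y r"
    unfolding star_radius_def using r by (auto simp: 1 edge_point_def split: if_splits)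
  then show ?thesis by (rule that)
next
  case (2 e t)
  have "star_radius y (min t (len e - t))"
    unfolding star_radius_def using 2 by (auto simp: edge_point_def split: if_splits)
  then show ?thesis by (rule that)
qed

text \<open>An end of \<open>e\<close> other than \<open>t0\<close> is at least \<open>r\<close>
  away from \<open>t0\<close>, so a move by less than \<open>r\<close> stops short of it.\<close>

lemma star_interior:
  assumes "star_radius y r" "e \<in> arcs G" "t0 \<in> {0..len e}" "ep e t0 = y"
    and "s \<in> {0..len e}" "s \<noteq> t0" "\<bar>s - t0\<bar> < r"
  shows "0 < s" "s < len e"
proof -
  have "(t0 = 0 \<or> r \<le> t0) \<and> (t0 = len e \<or> r \<le> len e - t0)"
    using assms(1-4) unfolding star_radius_def by blast
  then show "0 < s" "s < len e" using assms(5-7) by auto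
qed

text \<open>On a loop the vertex has two parameters; they are too far apart to be confused within
  the radius.\<close>

lemma star_base_unique:
  assumes "star_radius y r" "e \<in> arcs G" "t0 \<in> {0..len e}" "ep e t0 = y"
    and "s \<in> {0..len e}" "ep e s = y" "\<bar>s - t0\<bar> < r"
  shows "s = t0"
  using star_interior[OF assms(1-5) _ assms(7)] ep_inj[of s e e t0] assms(4,6) by metis

text \<open>Before it has length \<open>r\<close>, a path from \<open>y\<close> cannot reach a
  vertex other than \<open>y\<close>, so it can change edges only at \<open>y\<close> itself. The
  conclusion describes its last excursion from \<open>y\<close>.\<close>

lemma joined_star:
  assumes "star_radius y r" "joined G len y L z" "L < r"
  shows "z = y \<or> (\<exists>e \<in> arcs G. \<exists>t0 \<in> {0..len e}. \<exists>t \<in> {0..len e}.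
    ep e t0 = y \<and> z = ep e t \<and> \<bar>t - t0\<bar> \<le> L)"
  using assms(2,1,3)
proof (induction rule: joined.induct)
  case (joined_step y L e s t)
  have L0: "0 \<le> L" using joined_points[OF wf joined_step(1)] by simp
  have "ep e s = y \<or> (\<exists>e' \<in> arcs G. \<exists>t0 \<in> {0..len e'}. \<exists>t1 \<in> {0..len e'}.
    ep e' t0 = y \<and> ep e s = ep e' t1 \<and> \<bar>t1 - t0\<bar> \<le> L)"
    using joined_step.IH joined_step.prems by auto
  then show ?case
  proof
    assume "ep e s = y"
    then have "ep e s = y \<and> ep e t = ep e t \<and> \<bar>t - s\<bar> \<le> L + \<bar>s - t\<bar>" using L0 by auto
    then show ?thesis using joined_step(2-4) by blast
  next
    assume "\<exists>e' \<in> arcs G. \<exists>t0 \<in> {0..len e'}. \<exists>t1 \<in> {0..len e'}.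
      ep e' t0 = y \<and> ep e s = ep e' t1 \<and> \<bar>t1 - t0\<bar> \<le> L"
    then obtain e' t0 t1 where *: "e' \<in> arcs G" "t0 \<in> {0..len e'}" "t1 \<in> {0..len e'}"
      "ep e' t0 = y" "ep e s = ep e' t1" "\<bar>t1 - t0\<bar> \<le> L" by blast
    show ?thesis
    proof (cases "t1 = t0")
      case True
      \<comment> \<open>Back at \<open>y\<close>, the path may turn into another edge:
        \<open>s\<close> becomes the new base parameter.\<close>
      then have "ep e s = y \<and> ep e t = ep e t \<and> \<bar>t - s\<bar> \<le> L + \<bar>s - t\<bar>" using * L0 by auto
      then show ?thesis using joined_step(2-4) by blast
    next
      case False
      have "0 < t1" "t1 < len e'"
        using star_interior[OF joined_step.prems(1) *(1,2,4,3) False] * joined_step.prems(2) by auto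
      then have "e' = e" "t1 = s" using ep_inj[of t1 e' e s] *(5) by auto
      then have "ep e t0 = y \<and> ep e t = ep e t \<and> \<bar>t - t0\<bar> \<le> L + \<bar>s - t\<bar>" using * by auto
      then show ?thesis using joined_step(2,4) *(2) \<open>e' = e\<close> by blast
    qed
  qed
qed simp

text \<open>Within \<open>r / 2\<close> of \<open>y\<close>, no end of the edge is closer than the
  base parameter \<open>t0\<close>, because ends other than \<open>t0\<close> are at least
  \<open>r\<close> away from it.\<close>

lemma star_radius_arm:
  assumes "star_radius y r" "e \<in> arcs G" "t0 \<in> {0..len e}" "ep e t0 = y"
    and "t \<in> {0..len e}" "t \<noteq> t0" "\<bar>t - t0\<bar> \<le> r / 2"
  shows "star_radius (ep e t) \<bar>t - t0\<bar>"
proof -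
  have r: "0 < r" "(t0 = 0 \<or> r \<le> t0) \<and> (t0 = len e \<or> r \<le> len e - t0)"
    using assms(1-4) unfolding star_radius_def by blast+
  have int: "0 < t" "t < len e"
    using star_interior[OF assms(1-6)] assms(7) r(1) by auto
  have le: "\<bar>t - t0\<bar> \<le> t" "\<bar>t - t0\<bar> \<le> len e - t"
    using r assms(3,5,7) by (auto simp: abs_if split: if_splits)
  show ?thesis
    unfolding star_radius_def
  proof (intro conjI ballI impI)
    fix e' t' assume "ep e' t' = ep e t"
    then have "e' = e" "t' = t" using ep_inj[OF int, of e' t'] by auto
    then show "t' = 0 \<or> \<bar>t - t0\<bar> \<le> t'" "t' = len e' \<or> \<bar>t - t0\<bar> \<le> len e' - t'"
      using le by auto
  qed (use assms(6) in auto)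
qed

text \<open>The offset from \<open>t0\<close> is a star radius at \<open>ep e t\<close>, so
  \<open>joined_star\<close> applies there: a path too short to reach \<open>y\<close> stays inside
  \<open>e\<close>.\<close>

lemma joined_arm:
  assumes "star_radius y r" "e \<in> arcs G" "t0 \<in> {0..len e}" "ep e t0 = y"
    and "t \<in> {0..len e}" "\<bar>t - t0\<bar> \<le> r / 2"
    and "joined G len (ep e t) L z" "L < \<bar>t - t0\<bar>"
  obtains s where "0 < s" "s < len e" "z = ep e s" "\<bar>s - t\<bar> \<le> L"
proof -
  have L0: "0 \<le> L" using joined_points[OF wf assms(7)] by simp
  have ne: "t \<noteq> t0" using L0 assms(8) by auto
  have r: "0 < r" using assms(1) unfolding star_radius_def by blast
  have int: "0 < t" "t < len e"
    using star_interior[OF assms(1-5) ne] assms(6) r by auto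
  obtain s where s: "s \<in> {0..len e}" "z = ep e s" "\<bar>s - t\<bar> \<le> L"
  proof (cases "z = ep e t")
    case True
    then show ?thesis using that[of t] assms(5) L0 by simp
  next
    case False
    then show ?thesis
      using joined_star[OF star_radius_arm[OF assms(1-5) ne assms(6)] assms(7,8)]
        ep_inj[OF int] that by metis
  qed
  have "s \<noteq> t0" "\<bar>s - t0\<bar> < r" using s(3) assms(6,8) by arith+
  then show ?thesis using that s star_interior[OF assms(1-4) s(1)] by blast
qed

text \<open>A path too short to reach \<open>y\<close> stays on the arm and has at least its arc
  length. One long enough to reach \<open>y\<close> is no shorter either, since \<open>t1\<close>
  lies between \<open>t0\<close> and \<open>t2\<close>: the sign condition puts both on the same
  side.\<close>

lemma arm_dist:
  assumes "star_radius y r" "e \<in> arcs G" "t0 \<in> {0..len e}" "ep e t0 = y"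
    and "t1 \<in> {0..len e}" "t2 \<in> {0..len e}" "\<bar>t1 - t0\<bar> \<le> \<bar>t2 - t0\<bar>" "\<bar>t2 - t0\<bar> \<le> r / 2"
    and "0 \<le> (t1 - t0) * (t2 - t0)"
  shows "path_dist G len (ep e t2) (ep e t1) = \<bar>t2 - t1\<bar>"
proof (rule antisym)
  show "path_dist G len (ep e t2) (ep e t1) \<le> \<bar>t2 - t1\<bar>"
    by (intro path_dist_le joined_edge wf assms)
  show "\<bar>t2 - t1\<bar> \<le> path_dist G len (ep e t2) (ep e t1)"
  proof (intro path_dist_ge ep_in_points assms)
    fix L assume L: "joined G len (ep e t2) L (ep e t1)"
    have le: "\<bar>t2 - t1\<bar> \<le> \<bar>t2 - t0\<bar>"
      using assms(7,9) by (auto simp: zero_le_mult_iff abs_if split: if_splits)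
    show "\<bar>t2 - t1\<bar> \<le> L"
    proof (cases "L < \<bar>t2 - t0\<bar>")
      case True
      obtain s where s: "0 < s" "s < len e" "ep e t1 = ep e s" "\<bar>s - t2\<bar> \<le> L"
        using joined_arm[OF assms(1-4) assms(6,8) L True] by blast
      have "t1 = s" using ep_inj[of s e e t1] s by simp
      then show ?thesis using s(4) by simp
    qed (use le in simp)
  qed
qed

text \<open>Polar coordinates at \<open>y\<close>: by \<open>arm_dist\<close> the offset on the arm
  is the exact distance, not just a lower bound for path lengths.\<close>

lemma near_arm:
  assumes "star_radius y r" "y \<in> points G len" "z \<in> points G len" "z \<noteq> y" "path_dist G len y z < r / 2"
  obtains e t0 t where "e \<in> arcs G" "t0 \<in> {0..len e}" "t \<in> {0..len e}" "ep e t0 = y" "z = ep e t"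
    "\<bar>t - t0\<bar> = path_dist G len y z"
proof -
  have r: "0 < r" using assms(1) unfolding star_radius_def by blast
  obtain L where L: "joined G len y L z" "L < r / 2"
    using path_dist_less[OF assms(2,3,5)] by blast
  then obtain e t0 t where *: "e \<in> arcs G" "t0 \<in> {0..len e}" "t \<in> {0..len e}" "ep e t0 = y"
    "z = ep e t" "\<bar>t - t0\<bar> \<le> L"
    using joined_star[OF assms(1) L(1)] assms(4) r by auto
  have "path_dist G len z y = \<bar>t - t0\<bar>"
    using arm_dist[OF assms(1) *(1,2,4,2,3)] * L(2) by simp
  then show ?thesis using * that Metric_space.commute[OF metric, of y z] by metis
qed

text \<open>If the distance of two points is the difference of their distances to \<open>y\<close>,
  some path between them is too short to pass through \<open>y\<close>, so they are on the same
  arm.\<close>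

lemma same_arm_le:
  assumes "star_radius y r" "e \<in> arcs G" "t0 \<in> {0..len e}" "ep e t0 = y"
    and "t \<in> {0..len e}"
    and "e' \<in> arcs G" "t0' \<in> {0..len e'}" "ep e' t0' = y" "t' \<in> {0..len e'}"
    and "\<bar>t - t0\<bar> \<le> r / 4" "0 < \<bar>t' - t0'\<bar>" "\<bar>t' - t0'\<bar> \<le> \<bar>t - t0\<bar>"
    and "path_dist G len (ep e t) (ep e' t') = \<bar>t - t0\<bar> - \<bar>t' - t0'\<bar>"
  shows "e' = e \<and> t0' = t0 \<and> 0 < (t - t0) * (t' - t0')"
proof -
  obtain L where L: "joined G len (ep e t) L (ep e' t')" "L < \<bar>t - t0\<bar>"
    using path_dist_less[of "ep e t" "ep e' t'" "\<bar>t - t0\<bar>"] assms ep_in_points by auto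
  have r: "0 < r" using assms(1) unfolding star_radius_def by blast
  obtain s where s: "0 < s" "s < len e" "ep e' t' = ep e s" "\<bar>s - t\<bar> \<le> L"
    using joined_arm[OF assms(1-5) _ L] assms(10) r by auto
  have e: "e' = e" "t' = s" using ep_inj[of s e e' t'] s by auto
  \<comment> \<open>The way from \<open>t0\<close> over \<open>t\<close> and \<open>t'\<close> to
    \<open>t0'\<close> has three steps of at most \<open>r / 4\<close> each.\<close>
  have "\<bar>t0' - t0\<bar> < r" using assms(10-12) e(2) s(4) L(2) by arith
  then have "t0' = t0"
    using assms e by (intro star_base_unique[OF assms(1-4)]) auto
  moreover have "0 < (t - t0) * (t' - t0)"
    using s(4) L(2) e by (auto simp: zero_less_mult_iff abs_if split: if_splits)
  ultimately show ?thesis using e by simp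
qed

lemma same_arm:
  assumes "star_radius y r" "e \<in> arcs G" "t0 \<in> {0..len e}" "ep e t0 = y" "t \<in> {0..len e}"
    and "e' \<in> arcs G" "t0' \<in> {0..len e'}" "ep e' t0' = y" "t' \<in> {0..len e'}"
    and "0 < \<bar>t - t0\<bar>" "\<bar>t - t0\<bar> \<le> r / 4" "0 < \<bar>t' - t0'\<bar>" "\<bar>t' - t0'\<bar> \<le> r / 4"
    and "path_dist G len (ep e t) (ep e' t') = \<bar>\<bar>t - t0\<bar> - \<bar>t' - t0'\<bar>\<bar>"
  shows "e' = e \<and> t0' = t0 \<and> 0 < (t - t0) * (t' - t0')"
proof (cases "\<bar>t' - t0'\<bar> \<le> \<bar>t - t0\<bar>")
  case True
  then show ?thesis using assms by (intro same_arm_le[OF assms(1-9)]) auto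
next
  case False
  have "path_dist G len (ep e' t') (ep e t) = \<bar>t' - t0'\<bar> - \<bar>t - t0\<bar>"
    using False assms(14) Metric_space.commute[OF metric, of "ep e t"] by simp
  then have "e = e' \<and> t0 = t0' \<and> 0 < (t' - t0') * (t - t0)"
    using False assms by (intro same_arm_le[OF assms(1) assms(6-9) assms(2-5)]) auto
  then show ?thesis by (metis mult.commute)
qed

section \<open>Isometric curves and edges of models\<close>

text \<open>The distance of two points of the curve is the difference of their distances to its
  origin, and by \<open>same_arm\<close> this puts them on one arm. So the single reference point at
  \<open>\<rho>1\<close> determines edge and direction of the whole germ.\<close>

lemma isometric_germ:
  fixes \<gamma> :: "real \<Rightarrow> ('v, 'e) gpoint"
  assumes "0 < \<epsilon>" and pts: "\<And>\<rho>. 0 \<le> \<rho> \<Longrightarrow> \<rho> < \<epsilon> \<Longrightarrow> \<gamma> \<rho> \<in> points G len"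
    and iso: "\<And>\<rho> \<rho>'. 0 \<le> \<rho> \<Longrightarrow> \<rho> < \<epsilon> \<Longrightarrow> 0 \<le> \<rho>' \<Longrightarrow> \<rho>' < \<epsilon> \<Longrightarrow> path_dist G len (\<gamma> \<rho>) (\<gamma> \<rho>') = \<bar>\<rho> - \<rho>'\<bar>"
  obtains e t0 \<sigma> \<delta> where "e \<in> arcs G" "\<sigma> = 1 \<or> \<sigma> = -1" "0 < \<delta>"
    "\<And>\<rho>. 0 \<le> \<rho> \<Longrightarrow> \<rho> < \<delta> \<Longrightarrow> t0 + \<sigma> * \<rho> \<in> {0..len e} \<and> \<gamma> \<rho> = ep e (t0 + \<sigma> * \<rho>)"
proof -
  define y where "y = \<gamma> 0"
  have y: "y \<in> points G len" using pts[of 0] assms(1) unfolding y_def by simp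
  obtain r where r: "star_radius y r" using star_radius_ex[OF y] .
  have r0: "0 < r" using r unfolding star_radius_def by blast
  define \<delta> where "\<delta> = min \<epsilon> (r / 4)"
  have \<delta>: "0 < \<delta>" "\<delta> \<le> \<epsilon>" "\<delta> \<le> r / 4" unfolding \<delta>_def using assms(1) r0 by auto
  have arm: "\<exists>e t0 t. e \<in> arcs G \<and> t0 \<in> {0..len e} \<and> t \<in> {0..len e} \<and> ep e t0 = y \<and>
    \<gamma> \<rho> = ep e t \<and> \<bar>t - t0\<bar> = \<rho>" if "0 < \<rho>" "\<rho> < \<delta>" for \<rho>
  proof -
    have d: "path_dist G len y (\<gamma> \<rho>) = \<rho>"
      unfolding y_def using iso[of 0 \<rho>] that \<delta> by simp
    then have "\<gamma> \<rho> \<noteq> y" using Metric_space.mdist_zero[OF metric y] that by auto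
    moreover have "\<gamma> \<rho> \<in> points G len" "path_dist G len y (\<gamma> \<rho>) < r / 2"
      using pts[of \<rho>] that \<delta> d r0 by auto
    ultimately show ?thesis
      using near_arm[OF r y, of "\<gamma> \<rho>"] d by metis
  qed
  define \<rho>1 where "\<rho>1 = \<delta> / 2"
  have \<rho>1: "0 < \<rho>1" "\<rho>1 < \<delta>" unfolding \<rho>1_def using \<delta> by auto
  obtain e t0 t1 where *: "e \<in> arcs G" "t0 \<in> {0..len e}" "t1 \<in> {0..len e}" "ep e t0 = y"
    "\<gamma> \<rho>1 = ep e t1" "\<bar>t1 - t0\<bar> = \<rho>1" using arm[OF \<rho>1] by blast
  define \<sigma> where "\<sigma> = sgn (t1 - t0)"
  have \<sigma>: "\<sigma> = 1 \<or> \<sigma> = -1" using *(6) \<rho>1 unfolding \<sigma>_def sgn_if by auto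
  have "t0 + \<sigma> * \<rho> \<in> {0..len e} \<and> \<gamma> \<rho> = ep e (t0 + \<sigma> * \<rho>)" if "0 \<le> \<rho>" "\<rho> < \<delta>" for \<rho>
  proof (cases "\<rho> = 0")
    case True
    then show ?thesis using * by (simp add: y_def)
  next
    case False
    then obtain e' t0' t' where #: "e' \<in> arcs G" "t0' \<in> {0..len e'}" "t' \<in> {0..len e'}" "ep e' t0' = y"
      "\<gamma> \<rho> = ep e' t'" "\<bar>t' - t0'\<bar> = \<rho>" using arm[of \<rho>] \<open>0 \<le> \<rho>\<close> \<open>\<rho> < \<delta>\<close> by auto
    have "path_dist G len (ep e t1) (ep e' t') = \<bar>\<bar>t1 - t0\<bar> - \<bar>t' - t0'\<bar>\<bar>"
      using iso[of \<rho>1 \<rho>] \<rho>1 that \<delta> *(5,6) #(5,6) by simp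
    then have "e' = e \<and> t0' = t0 \<and> 0 < (t1 - t0) * (t' - t0')"
      using \<rho>1 that \<delta> False *(6) #(6)
      by (intro same_arm[OF r *(1,2,4,3) #(1,2,4,3)]) auto
    moreover from this have "t' = t0 + \<sigma> * \<rho>"
      using #(6) unfolding \<sigma>_def sgn_if by (auto simp: zero_less_mult_iff)
    ultimately show ?thesis using # by simp
  qed
  then show ?thesis using that[OF *(1) \<sigma> \<delta>(1)] by blast
qed

end

lemma is_model_metric_graph: "is_model H len \<phi> M d \<Longrightarrow> metric_graph H len"
  unfolding is_model_def metric_graph_def by auto

context metric_graph begin

text \<open>Near \<open>t\<close> the edge is an isometric curve by \<open>arm_dist\<close>. Pulled
  back to the model it is again one, so by \<open>isometric_germ\<close> it follows a single edge of
  the model, where \<open>f\<close> is linear with integer slope.\<close>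

lemma PL_Z_germ:
  assumes f: "f \<in> PL_Z G len" and e: "e \<in> arcs G" and t: "t \<in> {0..len e}"
    and \<tau>: "\<tau> = 1 \<or> \<tau> = -1" and \<epsilon>: "0 < \<epsilon>" and room: "t + \<tau> * \<epsilon> \<in> {0..len e}"
  shows "\<exists>a \<in> \<int>. \<exists>\<delta> > 0. \<forall>\<rho>. 0 \<le> \<rho> \<longrightarrow> \<rho> < \<delta> \<longrightarrow> f (ep e (t + \<tau> * \<rho>)) = f (ep e t) + a * (\<tau> * \<rho>)"
proof -
  obtain H :: "(nat, nat) pre_digraph" and len' \<phi> where
    H: "is_model H len' \<phi> (points G len) (path_dist G len)"
    and lin: "\<And>e'. e' \<in> arcs H \<Longrightarrow> \<exists>(a :: int) (b :: real). \<forall>s \<in> {0..len' e'}.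
      f (\<phi> (edge_point H len' e' s)) = of_int a * s + b"
    using f unfolding PL_Z_def by auto
  interpret H: metric_graph H len' using H by (rule is_model_metric_graph)
  have bij: "bij_betw \<phi> (points H len') (points G len)" using H unfolding is_model_def by blast
  have isoH: "path_dist G len (\<phi> x) (\<phi> y) = path_dist H len' x y"
    if "x \<in> points H len'" "y \<in> points H len'" for x y
    using H that unfolding is_model_def by blast
  define \<psi> where "\<psi> = inv_into (points H len') \<phi>"
  have \<psi>: "\<psi> x \<in> points H len'" "\<phi> (\<psi> x) = x" if "x \<in> points G len" for x
    using that bij_betw_imp_surj_on[OF bij] unfolding \<psi>_def
    by (auto simp: inv_into_into f_inv_into_f)
  obtain r where r: "star_radius (ep e t) r" using star_radius_ex[OF ep_in_points[OF e]] .
  have r0: "0 < r" using r unfolding star_radius_def by blast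
  \<comment> \<open>Up to \<open>r / 2\<close> the metric on the arm is arc length, and
    \<open>\<epsilon>\<close> keeps the curve on the edge.\<close>
  define \<eta> where "\<eta> = min \<epsilon> (r / 2)"
  have \<eta>: "0 < \<eta>" "\<eta> \<le> \<epsilon>" "\<eta> \<le> r / 2" unfolding \<eta>_def using \<epsilon> r0 by auto
  have in_edge: "t + \<tau> * \<rho> \<in> {0..len e}" if "0 \<le> \<rho>" "\<rho> < \<eta>" for \<rho>
    using \<tau> room t that \<eta> by auto
  have arm: "path_dist G len (ep e (t + \<tau> * \<rho>)) (ep e (t + \<tau> * \<rho>')) = \<bar>\<rho> - \<rho>'\<bar>"
    if "0 \<le> \<rho>'" "\<rho>' \<le> \<rho>" "\<rho> < \<eta>" for \<rho> \<rho>'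
    using arm_dist[OF r e t refl in_edge[of \<rho>'] in_edge[of \<rho>]] that \<tau> \<eta> by (auto simp: abs_minus_commute)
  have arm': "path_dist G len (ep e (t + \<tau> * \<rho>)) (ep e (t + \<tau> * \<rho>')) = \<bar>\<rho> - \<rho>'\<bar>"
    if "0 \<le> \<rho>" "\<rho> < \<eta>" "0 \<le> \<rho>'" "\<rho>' < \<eta>" for \<rho> \<rho>'
    using arm[of \<rho>' \<rho>] arm[of \<rho> \<rho>'] that Metric_space.commute[OF metric]
    by (cases "\<rho>' \<le> \<rho>") (auto simp: abs_minus_commute)
  obtain e' t0 \<sigma> \<delta> where *: "e' \<in> arcs H" "\<sigma> = 1 \<or> \<sigma> = -1" "0 < \<delta>"
    "\<And>\<rho>. 0 \<le> \<rho> \<Longrightarrow> \<rho> < \<delta> \<Longrightarrow> t0 + \<sigma> * \<rho> \<in> {0..len' e'} \<and>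
      \<psi> (ep e (t + \<tau> * \<rho>)) = edge_point H len' e' (t0 + \<sigma> * \<rho>)"
  proof (rule H.isometric_germ[where \<gamma> = "\<lambda>\<rho>. \<psi> (ep e (t + \<tau> * \<rho>))", OF \<eta>(1)])
    show "path_dist H len' (\<psi> (ep e (t + \<tau> * \<rho>))) (\<psi> (ep e (t + \<tau> * \<rho>'))) = \<bar>\<rho> - \<rho>'\<bar>"
      if "0 \<le> \<rho>" "\<rho> < \<eta>" "0 \<le> \<rho>'" "\<rho>' < \<eta>" for \<rho> \<rho>'
      using arm'[OF that] isoH[OF \<psi>(1) \<psi>(1), OF ep_in_points ep_in_points, OF e e] \<psi>(2)[OF ep_in_points[OF e]] by metis
  qed (use \<psi>(1) ep_in_points[OF e] in blast)+
  obtain a :: int and b :: real where ab: "\<And>s. s \<in> {0..len' e'} \<Longrightarrow> f (\<phi> (edge_point H len' e' s)) = of_int a * s + b"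
    using lin[OF *(1)] by blast
  have val: "f (ep e (t + \<tau> * \<rho>)) = of_int a * (t0 + \<sigma> * \<rho>) + b" if "0 \<le> \<rho>" "\<rho> < \<delta>" for \<rho>
    using *(4)[OF that] ab[of "t0 + \<sigma> * \<rho>"] \<psi>(2)[OF ep_in_points[OF e]] by metis
  \<comment> \<open>The integer \<open>a\<close> is a slope along the edge of the model; measured
    along \<open>e\<close> it acquires both signs \<open>\<sigma>\<close> and
    \<open>\<tau>\<close>.\<close>
  have "f (ep e (t + \<tau> * \<rho>)) = f (ep e t) + (of_int a * \<sigma> * \<tau>) * (\<tau> * \<rho>)" if "0 \<le> \<rho>" "\<rho> < \<delta>" for \<rho>
    using val[OF that] val[of 0] *(3) \<tau> by (auto simp: algebra_simps)
  moreover have "of_int a * \<sigma> * \<tau> \<in> \<int>" using *(2) \<tau> by auto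
  ultimately show ?thesis using *(3) by blast
qed

lemma PL_Z_pl_on:
  assumes f: "f \<in> PL_Z G len" and e: "e \<in> arcs G"
  shows "pl_on (len e) (\<lambda>t. f (ep e t))"
proof (rule pl_onI)
  fix t assume t: "0 \<le> t" "t < len e"
  obtain a \<delta> where a: "a \<in> \<int>" "0 < \<delta>"
    "\<And>\<rho>. 0 \<le> \<rho> \<Longrightarrow> \<rho> < \<delta> \<Longrightarrow> f (ep e (t + \<rho>)) = f (ep e t) + a * \<rho>"
    using PL_Z_germ[OF f e, of t 1 "len e - t"] t by auto
  have "f (ep e s) = f (ep e t) + a * (s - t)" if "t < s" "s < t + \<delta>" for s
    using a(3)[of "s - t"] that by simp
  then show "\<exists>a\<in>\<int>. \<forall>\<^sub>F s in at_right t. f (ep e s) = f (ep e t) + a * (s - t)"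
    using a(1,2) unfolding eventually_at_right_field by (intro bexI[of _ a] exI[of _ "t + \<delta>"]) auto
next
  fix t assume t: "0 < t" "t \<le> len e"
  obtain a \<delta> where a: "a \<in> \<int>" "0 < \<delta>"
    "\<And>\<rho>. 0 \<le> \<rho> \<Longrightarrow> \<rho> < \<delta> \<Longrightarrow> f (ep e (t - \<rho>)) = f (ep e t) - a * \<rho>"
    using PL_Z_germ[OF f e, of t "-1" t] t by auto
  have "f (ep e s) = f (ep e t) + a * (s - t)" if "t - \<delta> < s" "s < t" for s
    using a(3)[of "t - s"] that by (simp add: algebra_simps)
  then show "\<exists>a\<in>\<int>. \<forall>\<^sub>F s in at_left t. f (ep e s) = f (ep e t) + a * (s - t)"
    using a(1,2) unfolding eventually_at_left_field by (intro bexI[of _ a] exI[of _ "t - \<delta>"]) auto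
qed

end

section \<open>Continuity for the path metric\<close>

context metric_graph begin

lemma edge_lipschitz_dist:
  assumes "0 < K" and "\<And>e s t. e \<in> arcs G \<Longrightarrow> s \<in> {0..len e} \<Longrightarrow> t \<in> {0..len e} \<Longrightarrow>
      f (ep e t) \<le> f (ep e s) + K * \<bar>s - t\<bar>"
    and "x \<in> points G len" "y \<in> points G len"
  shows "\<bar>f x - f y\<bar> \<le> K * path_dist G len x y"
proof -
  have le: "f b - f a \<le> K * path_dist G len a b" if ab: "a \<in> points G len" "b \<in> points G len" for a b
  proof -
    \<comment> \<open>Dividing by \<open>K\<close> reduces to the constant 1 of
      \<open>joined_lipschitz\<close>.\<close>
    have "(f b - f a) / K \<le> path_dist G len a b"
    proof (rule path_dist_ge[OF ab])
      fix L assume "joined G len a L b"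
      then have "f b / K \<le> f a / K + L"
        by (rule joined_lipschitz) (use assms(1,2) in \<open>simp add: field_simps\<close>)
      then show "(f b - f a) / K \<le> L" by (simp add: diff_divide_distrib)
    qed
    then show ?thesis using assms(1) by (simp add: field_simps)
  qed
  show ?thesis
    using le[OF assms(3,4)] le[OF assms(4,3)] Metric_space.commute[OF metric, of x y] by simp
qed

lemma edge_lipschitz_continuous:
  assumes "0 < K" and "\<And>e s t. e \<in> arcs G \<Longrightarrow> s \<in> {0..len e} \<Longrightarrow> t \<in> {0..len e} \<Longrightarrow>
      f (ep e t) \<le> f (ep e s) + K * \<bar>s - t\<bar>"
  shows "continuous_map (graph_topology G len) euclideanreal f"
  unfolding graph_topology_def Metric_space.continuous_map_from_metric[OF metric]
proof (intro conjI ballI allI impI)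
  fix a U assume a: "a \<in> points G len" and "openin euclideanreal U \<and> f a \<in> U"
  then obtain \<epsilon> where \<epsilon>: "0 < \<epsilon>" "\<And>y. dist y (f a) < \<epsilon> \<Longrightarrow> y \<in> U"
    unfolding open_openin[symmetric] open_dist by blast
  have "f x \<in> U" if "x \<in> points G len" "path_dist G len a x < \<epsilon> / K" for x
  proof (rule \<epsilon>(2))
    have "\<bar>f a - f x\<bar> < \<epsilon>"
      using edge_lipschitz_dist[OF assms a that(1)] that(2) assms(1) by (simp add: field_simps)
    then show "dist (f x) (f a) < \<epsilon>" by (simp add: dist_real_def abs_minus_commute)
  qed
  then show "\<exists>r>0. \<forall>x. x \<in> points G len \<and> path_dist G len a x < r \<longrightarrow> f x \<in> U"
    using \<epsilon>(1) assms(1) by (intro exI[of _ "\<epsilon> / K"]) auto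
qed simp

lemma pl_on_continuous:
  assumes "\<And>e. e \<in> arcs G \<Longrightarrow> pl_on (len e) (\<lambda>t. f (ep e t))"
  shows "continuous_map (graph_topology G len) euclideanreal f"
proof -
  have "\<forall>e \<in> arcs G. \<exists>K \<ge> 0. \<forall>x \<in> {0..len e}. \<forall>y \<in> {0..len e}. \<bar>f (ep e x) - f (ep e y)\<bar> \<le> K * \<bar>x - y\<bar>"
    using pl_on_lipschitz[OF assms] len_pos by (simp add: less_imp_le)
  then obtain K where K: "\<And>e. e \<in> arcs G \<Longrightarrow> 0 \<le> K e"
    "\<And>e x y. e \<in> arcs G \<Longrightarrow> x \<in> {0..len e} \<Longrightarrow> y \<in> {0..len e} \<Longrightarrow> \<bar>f (ep e x) - f (ep e y)\<bar> \<le> K e * \<bar>x - y\<bar>"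
    unfolding bchoice_iff by blast
  \<comment> \<open>One constant for all edges; the summand 1 makes it positive.\<close>
  define M where "M = 1 + (\<Sum>e\<in>arcs G. K e)"
  have M: "K e \<le> M" if "e \<in> arcs G" for e
    unfolding M_def using member_le_sum[of e "arcs G" K] that K(1) finite_arcs by auto
  show ?thesis
  proof (rule edge_lipschitz_continuous)
    show "0 < M" unfolding M_def using sum_nonneg[of "arcs G" K] K(1) by auto
    fix e s t assume *: "e \<in> arcs G" "s \<in> {0..len e}" "t \<in> {0..len e}"
    have "\<bar>f (ep e s) - f (ep e t)\<bar> \<le> K e * \<bar>s - t\<bar>" using K(2)[OF *] .
    also have "\<dots> \<le> M * \<bar>s - t\<bar>" using M[OF *(1)] by (intro mult_right_mono) auto
    finally show "f (ep e t) \<le> f (ep e s) + M * \<bar>s - t\<bar>" by simp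
  qed
qed

end

section \<open>Refinements as models\<close>

text \<open>Sending each inner point to the tail of its edge turns every segment of a path into a
  step between ends of one edge, so a path in the metric graph becomes a walk.\<close>

lemma connected_if_joined:
  assumes "wf_digraph H" "verts H \<noteq> {}" "\<And>e. e \<in> arcs H \<Longrightarrow> 0 < l e"
    and "\<And>u v. u \<in> verts H \<Longrightarrow> v \<in> verts H \<Longrightarrow> \<exists>L. joined H l (Vertex u) L (Vertex v)"
  shows "Digraph_Component.connected H"
proof -
  define base where "base = (\<lambda>x. case x of Vertex w \<Rightarrow> w | Inner e t \<Rightarrow> tail H e)"
  define R where "R = rtrancl_on (verts H) (parcs (mk_symmetric H))"
  have edge: "(base (edge_point H l e s), base (edge_point H l e t)) \<in> R" if "e \<in> arcs H" for e s t
  proof -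
    have v: "tail H e \<in> verts H" "head H e \<in> verts H"
      using assms(1) that by (auto simp: wf_digraph.head_in_verts wf_digraph.tail_in_verts)
    have sym: "(tail H e, head H e) \<in> parcs (mk_symmetric H)" "(head H e, tail H e) \<in> parcs (mk_symmetric H)"
      using that by (auto simp: mk_symmetric_def)
    have "(a, b) \<in> R" if "a \<in> {tail H e, head H e}" "b \<in> {tail H e, head H e}" for a b
      using that v sym rtrancl_on_into_rtrancl_on[OF rtrancl_on_refl] unfolding R_def by auto
    moreover have "base (edge_point H l e r) \<in> {tail H e, head H e}" for r
      by (auto simp: base_def edge_point_def)
    ultimately show ?thesis by blast
  qed
  have R: "(base x, base y) \<in> R" if "joined H l x L y" for x L y
    using that
  proof induction
    case (joined_refl x)
    then show ?case using wf_digraph.tail_in_verts[OF assms(1)]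
      by (auto simp: points_def base_def R_def)
  next
    case (joined_step x L e s t)
    then show ?case using edge[of e s t] rtrancl_on_trans unfolding R_def by metis
  qed
  have "(u, v) \<in> R" if "u \<in> verts H" "v \<in> verts H" for u v
    using assms(4)[OF that] R by (force simp: base_def)
  then show ?thesis
    using assms(2) unfolding Digraph_Component.connected_def R_def
    by (intro strongly_connectedI) (auto simp: reachable_def mk_symmetric_def)
qed

text \<open>
  The edge \<open>e\<close> is cut at the points of \<open>B e\<close>; the resulting nodes and pieces are numbered
  by \<open>\<alpha>\<close> and \<open>\<beta>\<close>.
\<close>

locale refinement = metric_graph G len
  for G :: "('v, 'e) pre_digraph" and len +
  fixes B :: "'e \<Rightarrow> real set"
    and \<alpha> :: "nat \<Rightarrow> ('v, 'e) gpoint" and \<beta> :: "nat \<Rightarrow> 'e \<times> real \<times> real" and N K :: nat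
  assumes B: "e \<in> arcs G \<Longrightarrow> finite (B e) \<and> B e \<subseteq> {0..len e} \<and> 0 \<in> B e \<and> len e \<in> B e"
    and \<alpha>: "bij_betw \<alpha> {..<N} (Vertex ` verts G \<union> (\<Union>e \<in> arcs G. ep e ` B e))"
    and \<beta>: "bij_betw \<beta> {..<K} {(e, a, b). e \<in> arcs G \<and> a \<in> B e \<and> b \<in> B e \<and> a < b \<and> B e \<inter> {a<..<b} = {}}"
begin

abbreviation nodes :: "('v, 'e) gpoint set" where
  "nodes \<equiv> Vertex ` verts G \<union> (\<Union>e \<in> arcs G. ep e ` B e)"

abbreviation pieces :: "('e \<times> real \<times> real) set" where
  "pieces \<equiv> {(e, a, b). e \<in> arcs G \<and> a \<in> B e \<and> b \<in> B e \<and> a < b \<and> B e \<inter> {a<..<b} = {}}"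

definition piece_edge :: "nat \<Rightarrow> 'e" where "piece_edge j = fst (\<beta> j)"
definition lo :: "nat \<Rightarrow> real" where "lo j = fst (snd (\<beta> j))"
definition hi :: "nat \<Rightarrow> real" where "hi j = snd (snd (\<beta> j))"

text \<open>Vertices and arcs are numbers because \<open>PL_Z\<close> admits only models over
  \<open>nat\<close>.\<close>

definition refined :: "(nat, nat) pre_digraph" where
  "refined = \<lparr>verts = {..<N}, arcs = {..<K},
    tail = (\<lambda>j. inv_into {..<N} \<alpha> (ep (piece_edge j) (lo j))),
    head = (\<lambda>j. inv_into {..<N} \<alpha> (ep (piece_edge j) (hi j)))\<rparr>"

definition refined_len :: "nat \<Rightarrow> real" where
  "refined_len j = hi j - lo j"

definition unrefine :: "(nat, nat) gpoint \<Rightarrow> ('v, 'e) gpoint" where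
  "unrefine x = (case x of Vertex i \<Rightarrow> \<alpha> i | Inner j t \<Rightarrow> ep (piece_edge j) (lo j + t))"

lemma piece:
  assumes "j < K"
  shows "piece_edge j \<in> arcs G" "lo j \<in> B (piece_edge j)" "hi j \<in> B (piece_edge j)" "lo j < hi j"
    "B (piece_edge j) \<inter> {lo j<..<hi j} = {}" "0 \<le> lo j" "hi j \<le> len (piece_edge j)"
proof -
  have "\<beta> j \<in> pieces" using bij_betw_apply[OF \<beta>, of j] assms by simp
  then have *: "(piece_edge j, lo j, hi j) \<in> pieces" by (simp add: piece_edge_def lo_def hi_def)
  show **: "piece_edge j \<in> arcs G" "lo j \<in> B (piece_edge j)" "hi j \<in> B (piece_edge j)" "lo j < hi j"
    "B (piece_edge j) \<inter> {lo j<..<hi j} = {}"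
    using * by simp_all
  show "0 \<le> lo j" "hi j \<le> len (piece_edge j)" using B[OF **(1)] **(2,3) by auto
qed

text \<open>The piece runs from the last cut point up to \<open>s\<close> to the first cut point
  from \<open>t\<close> on. The final assumption excludes \<open>s = t\<close> in
  \<open>B e\<close>, where both would be the same point.\<close>

lemma piece_cover:
  assumes e: "e \<in> arcs G" and st: "0 \<le> s" "s \<le> t" "t \<le> len e" "B e \<inter> {s<..<t} = {}" "s < t \<or> s \<notin> B e"
  obtains j where "j < K" "piece_edge j = e" "lo j \<le> s" "t \<le> hi j"
proof -
  define a b where "a = Max (B e \<inter> {..s})" and "b = Min (B e \<inter> {t..})"
  have fin: "finite (B e \<inter> {..s})" "finite (B e \<inter> {t..})" using B[OF e] by auto
  have ne: "B e \<inter> {..s} \<noteq> {}" "B e \<inter> {t..} \<noteq> {}" using B[OF e] st by auto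
  have a: "a \<in> B e" "a \<le> s" "\<And>x. x \<in> B e \<Longrightarrow> x \<le> s \<Longrightarrow> x \<le> a"
    using Max_in[OF fin(1) ne(1)] Max_ge[OF fin(1)] unfolding a_def by auto
  have b: "b \<in> B e" "t \<le> b" "\<And>x. x \<in> B e \<Longrightarrow> t \<le> x \<Longrightarrow> b \<le> x"
    using Min_in[OF fin(2) ne(2)] Min_le[OF fin(2)] unfolding b_def by auto
  have "a < b"
  proof (rule ccontr)
    assume "\<not> a < b"
    then have "a = s" "s = t" using a(2) b(2) st(2) by auto
    then show False using a(1) st(5) by auto
  qed
  moreover have "B e \<inter> {a<..<b} = {}"
  proof (rule ccontr)
    assume "B e \<inter> {a<..<b} \<noteq> {}"
    then obtain x where x: "x \<in> B e" "a < x" "x < b" by auto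
    then have "s < x" "x < t" using a(3)[of x] b(3)[of x] by force+
    then show False using x(1) st(4) by auto
  qed
  ultimately have "(e, a, b) \<in> pieces" using e a b by auto
  then obtain j where "j < K" "\<beta> j = (e, a, b)"
    using bij_betw_imp_surj_on[OF \<beta>] by (metis (no_types, lifting) imageE lessThan_iff)
  then show ?thesis using that[of j] a(2) b(2) unfolding piece_edge_def lo_def hi_def by simp
qed

lemma \<alpha>_inv: "p \<in> nodes \<Longrightarrow> inv_into {..<N} \<alpha> p < N \<and> \<alpha> (inv_into {..<N} \<alpha> p) = p"
  using \<alpha> by (metis bij_betw_imp_surj_on f_inv_into_f inv_into_into lessThan_iff)

lemma piece_ends_nodes:
  assumes "j < K"
  shows "ep (piece_edge j) (lo j) \<in> nodes" "ep (piece_edge j) (hi j) \<in> nodes"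
  using piece(1-3)[OF assms] by blast+

lemma fin_refined: "fin_digraph refined"
  by unfold_locales (use \<alpha>_inv piece_ends_nodes in \<open>auto simp: refined_def\<close>)

lemma wf_refined: "wf_digraph refined"
  using fin_refined by (simp add: fin_digraph_def)

lemma refined_len_pos: "j \<in> arcs refined \<Longrightarrow> 0 < refined_len j"
  using piece(4) by (auto simp: refined_def refined_len_def)

lemma unrefine_edge_point:
  assumes "j < K" "t \<in> {0..refined_len j}"
  shows "unrefine (edge_point refined refined_len j t) = ep (piece_edge j) (lo j + t)"
proof -
  have ends: "\<alpha> (tail refined j) = ep (piece_edge j) (lo j)" "\<alpha> (head refined j) = ep (piece_edge j) (hi j)"
    using \<alpha>_inv[OF piece_ends_nodes(1)[OF assms(1)]] \<alpha>_inv[OF piece_ends_nodes(2)[OF assms(1)]]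
    by (auto simp: refined_def)
  consider "t = 0" | "0 < t" "t < refined_len j" | "0 < t" "t = refined_len j"
    using assms(2) by fastforce
  then show ?thesis
  proof cases
    case 1
    then show ?thesis using ends(1) by (simp add: unrefine_def edge_point_def[of refined])
  next
    case 2
    then show ?thesis by (simp add: unrefine_def edge_point_def[of refined])
  next
    case 3
    then have "lo j + t = hi j" by (simp add: refined_len_def)
    then show ?thesis
      using 3 ends(2) by (simp add: unrefine_def edge_point_def[of refined])
  qed
qed

lemma refined_edge_point_in: "j < K \<Longrightarrow> edge_point refined refined_len j t \<in> points refined refined_len"
  by (rule edge_point_in_points[OF wf_refined]) (simp add: refined_def)

lemma nodes_in_points: "nodes \<subseteq> points G len"
  using ep_in_points by (auto simp: points_def)

lemma unrefine_Inner:
  assumes "Inner j t \<in> points refined refined_len"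
  shows "j < K" "0 < t" "t < refined_len j" "unrefine (Inner j t) = Inner (piece_edge j) (lo j + t)"
    "lo j + t \<notin> B (piece_edge j)" "unrefine (Inner j t) \<notin> nodes"
proof -
  show *: "j < K" "0 < t" "t < refined_len j"
    using assms by (auto simp: points_def refined_def)
  have int: "0 < lo j + t" "lo j + t < len (piece_edge j)"
    using * piece[OF *(1)] by (auto simp: refined_len_def)
  then show **: "unrefine (Inner j t) = Inner (piece_edge j) (lo j + t)"
    by (simp add: unrefine_def ep_inner)
  show ***: "lo j + t \<notin> B (piece_edge j)" using piece(5)[OF *(1)] * by (auto simp: refined_len_def)
  show "unrefine (Inner j t) \<notin> nodes"
  proof
    assume "unrefine (Inner j t) \<in> nodes"
    then obtain e b where "e \<in> arcs G" "b \<in> B e" "ep e b = ep (piece_edge j) (lo j + t)"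
      unfolding ** using int by (auto simp: ep_inner)
    then show False using ep_inj[OF int, of e b] *** by auto
  qed
qed

lemma unrefine_Vertex: "Vertex i \<in> points refined refined_len \<Longrightarrow> i < N \<and> unrefine (Vertex i) = \<alpha> i \<and> \<alpha> i \<in> nodes"
  using bij_betwE[OF \<alpha>] by (auto simp: points_def refined_def unrefine_def)

lemma inj_unrefine: "inj_on unrefine (points refined refined_len)"
proof (rule inj_onI)
  fix x y assume x: "x \<in> points refined refined_len" and y: "y \<in> points refined refined_len"
    and eq: "unrefine x = unrefine y"
  show "x = y"
  proof (cases x)
    case (Vertex i)
    note i = unrefine_Vertex[OF x[unfolded Vertex]]
    show ?thesis
    proof (cases y)
      case i': (Vertex i')
      then have "\<alpha> i = \<alpha> i'" "i < N" "i' < N"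
        using i unrefine_Vertex[of i'] y eq Vertex by simp_all
      then have "i = i'" using bij_betw_imp_inj_on[OF \<alpha>] by (simp add: inj_on_eq_iff)
      then show ?thesis using Vertex i' by simp
    next
      case j': (Inner j' t')
      show ?thesis using unrefine_Inner(6)[OF y[unfolded j']] i eq unfolding Vertex j' by metis
    qed
  next
    case (Inner j t)
    obtain j' t' where j': "y = Inner j' t'"
    proof (cases y)
      case i': (Vertex i')
      show ?thesis
        using unrefine_Inner(6)[OF x[unfolded Inner]] unrefine_Vertex[OF y[unfolded i']] eq
        unfolding Inner i' by metis
    qed blast
    note X = unrefine_Inner[OF x[unfolded Inner]] and Y = unrefine_Inner[OF y[unfolded j']]
    have e: "piece_edge j' = piece_edge j" and t: "lo j + t = lo j' + t'"
      using eq X(4) Y(4) Inner j' by auto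
    \<comment> \<open>No end of one piece lies strictly inside the other, so two pieces of an edge
      with a common interior point coincide.\<close>
    have "lo j' \<notin> {lo j<..<hi j}" "lo j \<notin> {lo j'<..<hi j'}" "hi j' \<notin> {lo j<..<hi j}" "hi j \<notin> {lo j'<..<hi j'}"
      using piece(2,3,5)[OF X(1)] piece(2,3,5)[OF Y(1)] unfolding e by blast+
    then have "lo j = lo j'" "hi j = hi j'"
      using X(2,3) Y(2,3) t unfolding refined_len_def by auto
    then have "\<beta> j = \<beta> j'" using e unfolding piece_edge_def lo_def hi_def by (simp add: prod_eq_iff)
    then have "j = j'" using bij_betw_imp_inj_on[OF \<beta>] X(1) Y(1) by (auto dest: inj_onD)
    then show ?thesis using t Inner j' by simp
  qed
qed

lemma unrefine_surj: "unrefine ` points refined refined_len = points G len"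
proof
  show "unrefine ` points refined refined_len \<subseteq> points G len"
  proof
    fix y assume "y \<in> unrefine ` points refined refined_len"
    then obtain x where x: "x \<in> points refined refined_len" "y = unrefine x" by blast
    show "y \<in> points G len"
    proof (cases x)
      case (Vertex i)
      then have "unrefine x \<in> nodes" using unrefine_Vertex[of i] x(1) by metis
      then show ?thesis using nodes_in_points x(2) by blast
    next
      case (Inner j t)
      then show ?thesis using unrefine_Inner(1)[of j t] x piece(1) ep_in_points by (auto simp: unrefine_def)
    qed
  qed
  have node: "p \<in> unrefine ` points refined refined_len" if "p \<in> nodes" for p
    using \<alpha>_inv[OF that] by (intro image_eqI[of _ _ "Vertex (inv_into {..<N} \<alpha> p)"])
      (auto simp: unrefine_def points_def refined_def)
  show "points G len \<subseteq> unrefine ` points refined refined_len"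
  proof
    fix y assume "y \<in> points G len"
    then show "y \<in> unrefine ` points refined refined_len"
    proof (cases rule: points_cases)
      case (1 v)
      then show ?thesis by (intro node) auto
    next
      case (2 e t)
      show ?thesis
      proof (cases "t \<in> B e")
        case True
        then have "y \<in> ep e ` B e" using 2(5) by blast
        then show ?thesis using 2(2) by (intro node) blast
      next
        case False
        obtain j where j: "j < K" "piece_edge j = e" "lo j \<le> t" "t \<le> hi j"
          using piece_cover[OF 2(2), of t t] 2 False by auto
        then have "y = unrefine (edge_point refined refined_len j (t - lo j))"
          using 2 by (subst unrefine_edge_point) (auto simp: refined_len_def)
        then show ?thesis using refined_edge_point_in[OF j(1)] by blast
      qed
    qed
  qed
qed

lemma joined_unrefine:
  assumes "joined refined refined_len x L y"
  shows "joined G len (unrefine x) L (unrefine y)"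
  using assms
proof induction
  case (joined_refl x)
  then show ?case using unrefine_surj by (intro joined.joined_refl) blast
next
  case (joined_step x L j s t)
  have j: "j < K" using joined_step(2) by (simp add: refined_def)
  have "joined G len (unrefine x) (L + \<bar>(lo j + s) - (lo j + t)\<bar>) (ep (piece_edge j) (lo j + t))"
    using joined_step piece[OF j] unrefine_edge_point[OF j]
    by (intro joined.joined_step) (auto simp: refined_len_def)
  then show ?case using unrefine_edge_point[OF j joined_step(4)] by simp
qed

text \<open>A segment inside one piece lifts directly; one that crosses cut points is split there.
  The lifts \<open>x\<close> and \<open>y\<close> are quantified inside the induction since the
  parts meet at the lift of a cut point.\<close>

lemma joined_refine_edge:
  assumes e: "e \<in> arcs G" and "s \<le> t"
  shows "0 \<le> s \<longrightarrow> t \<le> len e \<longrightarrow> (\<forall>x \<in> points refined refined_len. \<forall>y \<in> points refined refined_len.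
    unrefine x = ep e s \<longrightarrow> unrefine y = ep e t \<longrightarrow> joined refined refined_len x (t - s) y)"
    (is "?P s t")
proof (rule finite_split_induct[where P = ?P, OF _ \<open>s \<le> t\<close>])
  show "finite (B e)" using B[OF e] by blast
next
  fix s t assume st: "s \<le> t" "B e \<inter> {s<..<t} = {}"
  show "?P s t"
  proof (intro impI ballI)
    fix x y assume s0: "0 \<le> s" and tl: "t \<le> len e" and x: "x \<in> points refined refined_len"
      and y: "y \<in> points refined refined_len" and xs: "unrefine x = ep e s" and yt: "unrefine y = ep e t"
    show "joined refined refined_len x (t - s) y"
    proof (cases "s = t")
      case True
      then have "x = y" using inj_onD[OF inj_unrefine _ x y] xs yt by simp
      then show ?thesis using True joined_refl[OF x] by simp
    next
      case False
      obtain j where j: "j < K" "piece_edge j = e" "lo j \<le> s" "t \<le> hi j"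
        using piece_cover[OF e s0 st(1) tl st(2)] False st(1) by auto
      define a b where "a = s - lo j" and "b = t - lo j"
      have ab: "a \<in> {0..refined_len j}" "b \<in> {0..refined_len j}" "t - s = \<bar>a - b\<bar>"
        using j st(1) by (auto simp: refined_len_def a_def b_def)
      have "x = edge_point refined refined_len j a"
        using xs unrefine_edge_point[OF j(1) ab(1)] j(2)
        by (intro inj_onD[OF inj_unrefine _ x refined_edge_point_in[OF j(1)]]) (simp add: a_def)
      moreover have "y = edge_point refined refined_len j b"
        using yt unrefine_edge_point[OF j(1) ab(2)] j(2)
        by (intro inj_onD[OF inj_unrefine _ y refined_edge_point_in[OF j(1)]]) (simp add: b_def)
      ultimately show ?thesis
        unfolding ab(3) using ab(1,2) j(1)
        using joined_edge[of refined j a refined_len b] wf_refined by (simp add: refined_def)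
    qed
  qed
next
  fix s b t assume b: "s < b" "b < t" and P: "?P s b" "?P b t"
  show "?P s t"
  proof (intro impI ballI)
    fix x y assume s0: "0 \<le> s" and tl: "t \<le> len e" and x: "x \<in> points refined refined_len"
      and y: "y \<in> points refined refined_len" and xs: "unrefine x = ep e s" and yt: "unrefine y = ep e t"
    obtain z where "z \<in> points refined refined_len" "unrefine z = ep e b"
      using ep_in_points[OF e, of b] unrefine_surj by (metis imageE)
    then have "joined refined refined_len x (b - s) z" "joined refined refined_len z (t - b) y"
      using P x y xs yt s0 tl b by auto
    from joined_trans[OF this(2,1)] show "joined refined refined_len x (t - s) y" by simp
  qed
qed

lemma joined_refine:
  assumes "joined G len p L q"
    and "x \<in> points refined refined_len" "unrefine x = p" "y \<in> points refined refined_len" "unrefine y = q"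
  shows "joined refined refined_len x L y"
  using assms(1,3,4,5)
proof (induction arbitrary: y)
  case (joined_refl p)
  have "unrefine x = unrefine y" using joined_refl by simp
  then have "x = y" by (rule inj_onD[OF inj_unrefine]) (rule assms(2), rule joined_refl)
  then show ?case using joined.joined_refl[OF assms(2)] by simp
next
  case (joined_step p L e s t)
  obtain z where z: "z \<in> points refined refined_len" "unrefine z = ep e s"
    using ep_in_points[OF joined_step(2), of s] unrefine_surj by (metis imageE)
  have "joined refined refined_len z \<bar>s - t\<bar> y"
  proof (cases "s \<le> t")
    case True
    then show ?thesis using joined_refine_edge[OF joined_step(2) True] joined_step z by auto
  next
    case False
    then have "joined refined refined_len y \<bar>s - t\<bar> z"
      using joined_refine_edge[OF joined_step(2), of t s] joined_step z by auto
    then show ?thesis by (rule joined_sym[OF wf_refined])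
  qed
  from joined_trans[OF this joined_step.IH[OF joined_step.prems(1) z]] show ?case .
qed

text \<open>The same path lengths occur on both sides, so the infima agree and no distance has to be
  computed.\<close>

lemma unrefine_isometry:
  assumes "x \<in> points refined refined_len" "y \<in> points refined refined_len"
  shows "path_dist G len (unrefine x) (unrefine y) = path_dist refined refined_len x y"
proof -
  have "joined G len (unrefine x) L (unrefine y) = joined refined refined_len x L y" for L
    using joined_refine[OF _ assms(1) refl assms(2) refl] joined_unrefine by blast
  moreover have "unrefine x \<in> points G len" "unrefine y \<in> points G len"
    using assms unrefine_surj by blast+
  ultimately show ?thesis using assms unfolding path_dist_def by simp
qed

lemma is_model_refined: "is_model refined refined_len unrefine (points G len) (path_dist G len)"
proof -
  have "verts refined \<noteq> {}"
  proof -
    obtain v where "v \<in> verts G"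
      using conn unfolding Digraph_Component.connected_def strongly_connected_def by (auto simp: mk_symmetric_def)
    then show ?thesis using \<alpha>_inv[of "Vertex v"] by (auto simp: refined_def)
  qed
  moreover have "\<exists>L. joined refined refined_len (Vertex u) L (Vertex v)"
    if "u \<in> verts refined" "v \<in> verts refined" for u v
  proof -
    have uv: "Vertex u \<in> points refined refined_len" "Vertex v \<in> points refined refined_len"
      using that by (auto simp: points_def)
    then have "unrefine (Vertex u) \<in> points G len" "unrefine (Vertex v) \<in> points G len"
      using unrefine_surj by blast+
    from joined_ex_points[OF this] show ?thesis
      using joined_refine[OF _ uv(1) refl uv(2) refl] by auto
  qed
  ultimately have "Digraph_Component.connected refined"
    using refined_len_pos by (intro connected_if_joined[OF wf_refined])
  then show ?thesis
    unfolding is_model_def bij_betw_def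
    using fin_refined refined_len_pos inj_unrefine unrefine_surj unrefine_isometry by blast
qed

end

section \<open>Edgewise description of \<open>PL_Z\<close>\<close>

context metric_graph begin

text \<open>Cutting each edge at its kinks gives a model on whose edges \<open>f\<close> is affine
  by \<open>pl_on_affine\<close>, with the right slope at the lower end of the piece.\<close>

lemma pl_on_PL_Z:
  assumes pl: "\<And>e. e \<in> arcs G \<Longrightarrow> pl_on (len e) (\<lambda>t. f (ep e t))"
  shows "f \<in> PL_Z G len"
proof -
  define B where "B = (\<lambda>e. {0, len e} \<union>
    {t \<in> {0<..<len e}. rslope (\<lambda>t. f (ep e t)) t \<noteq> lslope (\<lambda>t. f (ep e t)) t})"
  have B: "finite (B e) \<and> B e \<subseteq> {0..len e} \<and> 0 \<in> B e \<and> len e \<in> B e" if "e \<in> arcs G" for e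
    using finite_kinks[OF pl[OF that]] len_pos[OF that] unfolding B_def by (auto simp: less_imp_le)
  define V where "V = Vertex ` verts G \<union> (\<Union>e \<in> arcs G. ep e ` B e)"
  define A where "A = {(e, a, b). e \<in> arcs G \<and> a \<in> B e \<and> b \<in> B e \<and> a < b \<and> B e \<inter> {a<..<b} = {}}"
  have "finite V" unfolding V_def using finite_arcs finite_verts B by blast
  moreover have "finite A"
  proof (rule finite_subset)
    show "A \<subseteq> (SIGMA e : arcs G. B e \<times> B e)" unfolding A_def by auto
    show "finite (SIGMA e : arcs G. B e \<times> B e)" using finite_arcs B by (intro finite_SigmaI) auto
  qed
  ultimately obtain \<alpha> \<beta> where "bij_betw \<alpha> {..<card V} V" "bij_betw \<beta> {..<card A} A"
    using ex_bij_betw_nat_finite[of V] ex_bij_betw_nat_finite[of A] unfolding atLeast0LessThan by blast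
  then interpret refinement G len B \<alpha> \<beta> "card V" "card A"
    by (intro refinement.intro metric_graph_axioms refinement_axioms.intro B) (simp_all only: V_def A_def)
  have "\<exists>(a :: int) (b :: real). \<forall>t \<in> {0..refined_len j}.
      f (unrefine (edge_point refined refined_len j t)) = of_int a * t + b" if "j \<in> arcs refined" for j
  proof -
    have j: "j < card A" using that by (simp add: refined_def)
    note p = piece[OF j]
    define u where "u = (\<lambda>t. f (ep (piece_edge j) t))"
    have u: "pl_on (len (piece_edge j)) u" unfolding u_def by (rule pl[OF p(1)])
    have nk: "rslope u t = lslope u t" if t: "lo j < t" "t < hi j" for t
    proof (rule ccontr)
      assume "rslope u t \<noteq> lslope u t"
      then have "t \<in> B (piece_edge j)" using p(6,7) t unfolding B_def u_def by simp
      then show False using p(5) t by (simp add: disjoint_iff)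
    qed
    obtain a where a: "rslope u (lo j) = of_int a"
      using pl_on_right(1)[OF u, of "lo j"] p by (auto elim: Ints_cases)
    have "f (unrefine (edge_point refined refined_len j t)) = of_int a * t + u (lo j)"
      if "t \<in> {0..refined_len j}" for t
      using unrefine_edge_point[OF j that] pl_on_affine(1)[OF u p(6,4,7) nk, of "lo j + t"] that a
      unfolding u_def by (simp add: refined_len_def)
    then show ?thesis by blast
  qed
  then show ?thesis
    unfolding PL_Z_def using is_model_refined pl_on_continuous[OF pl] by blast
qed

text \<open>Frees the rest of the proof from models: from here on only one-variable functions on the
  edges of \<open>G\<close> matter.\<close>

lemma PL_Z_iff: "f \<in> PL_Z G len \<longleftrightarrow> (\<forall>e \<in> arcs G. pl_on (len e) (\<lambda>t. f (ep e t)))"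
  using PL_Z_pl_on pl_on_PL_Z by blast

end

section \<open>Cycles carry unit flows\<close>

text \<open>Rotating from \<open>p\<close> through the angles strictly between 0 and
  \<open>2 * pi\<close> parametrises the rest of the circle by an interval.\<close>

lemma connected_punctured_circle:
  fixes p :: complex
  assumes "p \<in> sphere 0 1"
  shows "Topological_Spaces.connected (sphere 0 1 - {p})"
proof -
  have p: "norm p = 1" "p \<noteq> 0" using assms by auto
  have "sphere 0 1 - {p} = (\<lambda>t. p * cis t) ` {0<..<2 * pi}"
  proof
    show "sphere 0 1 - {p} \<subseteq> (\<lambda>t. p * cis t) ` {0<..<2 * pi}"
    proof
      fix z assume z: "z \<in> sphere 0 1 - {p}"
      define t where "t = Arg2pi (z / p)"
      have "z / p = cis t"
        using z p Arg2pi_eq[of "z / p"] by (simp add: t_def cis_conv_exp norm_divide)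
      moreover from this have "t \<noteq> 0" using z p by auto
      moreover have "0 \<le> t" "t < 2 * pi" unfolding t_def by (rule Arg2pi_ge_0, rule Arg2pi_lt_2pi)
      ultimately show "z \<in> (\<lambda>t. p * cis t) ` {0<..<2 * pi}"
        using p by (intro image_eqI[of _ _ t]) (auto simp: field_simps)
    qed
    show "(\<lambda>t. p * cis t) ` {0<..<2 * pi} \<subseteq> sphere 0 1 - {p}"
    proof
      fix z assume "z \<in> (\<lambda>t. p * cis t) ` {0<..<2 * pi}"
      then obtain t where "t \<in> {0<..<2 * pi}" "z = p * cis t" by blast
      then have t: "z = p * cis t" "0 < t" "t < 2 * pi" by simp_all
      have "cis t \<noteq> 1"
      proof
        assume "cis t = 1"
        then have "cos t = 1" by (metis cis.simps(1) one_complex.simps(1))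
        then obtain n :: int where "t = n * (2 * pi)" by (auto simp: cos_one_2pi_int)
        then have "0 < n" "n < 1" using t(2,3) by (auto simp: zero_less_mult_iff)
        then show False by simp
      qed
      then show "z \<in> sphere 0 1 - {p}" using t(1) p by (auto simp: norm_mult)
    qed
  qed
  then show ?thesis
    by (auto intro!: connected_continuous_image continuous_intros simp: is_interval_connected)
qed

lemma (in metric_graph) topspace_graph_topology: "topspace (graph_topology G len) = points G len"
  unfolding graph_topology_def by (rule Metric_space.topspace_mtopology[OF metric])

text \<open>
  If the edge \<open>e\<close> were a bridge, a function that is negative on one side and positive on the
  other side of its midpoint would disconnect a punctured circle.
\<close>

lemma circle_no_bridge:
  fixes C :: "('v, 'e) pre_digraph"
  assumes C: "metric_graph C (\<lambda>_. 1)"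
    and homeo: "graph_topology C (\<lambda>_. 1) homeomorphic_space top_of_set (sphere (0 :: complex) 1)"
    and e: "e \<in> arcs C" and T: "tail C e \<in> T" "head C e \<notin> T"
    and closed: "\<And>a. a \<in> arcs C \<Longrightarrow> a \<noteq> e \<Longrightarrow> tail C a \<in> T \<longleftrightarrow> head C a \<in> T"
  shows False
proof -
  interpret C: metric_graph C "\<lambda>_. 1" by (rule C)
  obtain \<phi> \<psi> where maps: "homeomorphic_maps (graph_topology C (\<lambda>_. 1)) (top_of_set (sphere (0 :: complex) 1)) \<phi> \<psi>"
    using homeo unfolding homeomorphic_space_def by blast
  \<comment> \<open>The assumption \<open>closed\<close> makes the values off \<open>e\<close>
    consistent at the vertices, so \<open>g\<close> is 1-Lipschitz on every edge, and its only zero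
    is the midpoint of \<open>e\<close>.\<close>
  define g :: "('v, 'e) gpoint \<Rightarrow> real" where
    "g = (\<lambda>x. case x of Vertex w \<Rightarrow> if w \<in> T then -1/2 else 1/2
      | Inner a t \<Rightarrow> if a = e then t - 1/2 else if tail C a \<in> T then -1/2 else 1/2)"
  have gep: "g (C.ep a t) = (if a = e then t - 1/2 else if tail C a \<in> T then -1/2 else 1/2)"
    if "a \<in> arcs C" "t \<in> {0..1}" for a t
    using that T closed[of a] by (auto simp: g_def edge_point_def)
  have "continuous_map (graph_topology C (\<lambda>_. 1)) euclideanreal g"
    by (rule C.edge_lipschitz_continuous[of 1]) (auto simp: gep)
  then have cont: "continuous_on (sphere 0 1) (g \<circ> \<psi>)"
    using maps continuous_map_compose[of "top_of_set (sphere 0 1)" _ \<psi> euclideanreal g]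
    unfolding homeomorphic_maps_def by auto
  have \<phi>: "\<phi> x \<in> sphere 0 1" "\<psi> (\<phi> x) = x" if "x \<in> points C (\<lambda>_. 1)" for x
    using maps that C.topspace_graph_topology unfolding homeomorphic_maps_def continuous_map_def by auto
  have \<psi>: "\<psi> z \<in> points C (\<lambda>_. 1)" "\<phi> (\<psi> z) = z" if "z \<in> sphere 0 1" for z
    using maps that C.topspace_graph_topology unfolding homeomorphic_maps_def continuous_map_def by auto
  define m where "m = (Inner e (1/2) :: ('v, 'e) gpoint)"
  have "Inner e (1/2) = C.ep e (1/2)" by (simp add: edge_point_def)
  then have m: "m \<in> points C (\<lambda>_. 1)" using C.ep_in_points[OF e] unfolding m_def by simp
  define S where "S = (g \<circ> \<psi>) ` (sphere 0 1 - {\<phi> m})"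
  have "Topological_Spaces.connected S"
    unfolding S_def using cont connected_punctured_circle[OF \<phi>(1)[OF m]]
    by (blast intro: connected_continuous_image continuous_on_subset)
  moreover have "g x \<in> S" if "x \<in> points C (\<lambda>_. 1)" "x \<noteq> m" for x
    unfolding S_def using \<phi>[OF that(1)] \<phi>[OF m] that(2) by (intro image_eqI[of _ _ "\<phi> x"]) auto
  moreover have "Vertex (tail C e) \<in> points C (\<lambda>_. 1)" "Vertex (head C e) \<in> points C (\<lambda>_. 1)"
    using e C.wf by (auto simp: points_def wf_digraph.tail_in_verts wf_digraph.head_in_verts)
  ultimately have "g (Vertex (tail C e)) \<in> S" "g (Vertex (head C e)) \<in> S"
    by (auto simp: m_def)
  \<comment> \<open>Both ends of \<open>e\<close> survive the puncture, so by connectedness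
    \<open>g\<close> takes the value 0 away from the midpoint.\<close>
  then have "{-1/2..1/2} \<subseteq> S"
    using \<open>Topological_Spaces.connected S\<close> T by (intro connected_contains_Icc) (auto simp: g_def)
  then have "0 \<in> S" by (auto simp: subset_iff)
  then obtain z where "z \<in> sphere 0 1 - {\<phi> m}" "0 = (g \<circ> \<psi>) z" unfolding S_def by (rule imageE) blast
  then have z: "z \<in> sphere 0 1" "z \<noteq> \<phi> m" "g (\<psi> z) = 0" by simp_all
  have "\<psi> z = m"
    using z(3) \<psi>(1)[OF z(1)] unfolding g_def m_def by (auto simp: points_def split: if_splits)
  then show False using \<psi>(2)[OF z(1)] z(2) by simp
qed

text \<open>
  \<open>unit_path G A u S c v\<close>: a path from \<open>u\<close> to \<open>v\<close> along arcs in \<open>A\<close> in either direction visits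
  each vertex of \<open>S\<close> exactly once; \<open>c\<close> is the associated unit flow.
\<close>

inductive unit_path ::
  "('v, 'e) pre_digraph \<Rightarrow> 'e set \<Rightarrow> 'v \<Rightarrow> 'v set \<Rightarrow> ('e \<Rightarrow> int) \<Rightarrow> 'v \<Rightarrow> bool" for G A u where
  stay: "unit_path G A u {u} (\<lambda>_. 0) u"
| forward: "unit_path G A u S c v \<Longrightarrow> a \<in> A \<Longrightarrow> tail G a = v \<Longrightarrow> head G a = w \<Longrightarrow> w \<notin> S \<Longrightarrow>
    unit_path G A u (insert w S) (c(a := 1)) w"
| backward: "unit_path G A u S c v \<Longrightarrow> a \<in> A \<Longrightarrow> head G a = v \<Longrightarrow> tail G a = w \<Longrightarrow> w \<notin> S \<Longrightarrow>
    unit_path G A u (insert w S) (c(a := -1)) w"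

lemma unit_path_props:
  assumes "unit_path G A u S c v"
  shows "v \<in> S \<and> (\<forall>a. \<bar>c a\<bar> \<le> 1) \<and> (\<forall>a. c a \<noteq> 0 \<longrightarrow> a \<in> A \<and> tail G a \<in> S \<and> head G a \<in> S)"
  using assms by induction auto

text \<open>Increments of \<open>h\<close> telescope along the path. Closing it by one more arc will
  therefore give total 0, which is Kirchhoff's law tested against \<open>h\<close>.\<close>

lemma unit_path_flow:
  fixes h :: "'v \<Rightarrow> real"
  assumes "unit_path G A u S c v" "finite A"
  shows "(\<Sum>a \<in> A. of_int (c a) * (h (head G a) - h (tail G a))) = h v - h u"
  using assms(1)
proof induction
  case (forward S c v a w)
  \<comment> \<open>The new arc meets \<open>w\<close>, which is outside of \<open>S\<close>, while
    \<open>c\<close> vanishes off the arcs within \<open>S\<close>: the update adds a term and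
    overwrites none.\<close>
  have "c a = 0" using unit_path_props[OF forward(1)] forward(4,5) by metis
  then have "(\<Sum>b \<in> A. of_int ((c(a := 1)) b) * (h (head G b) - h (tail G b))) =
    (\<Sum>b \<in> A. of_int (c b) * (h (head G b) - h (tail G b)) + (if b = a then h w - h v else 0))"
    using forward(3,4) by (intro sum.cong) auto
  also have "\<dots> = h w - h u" using forward assms(2) by (simp add: sum.distrib)
  finally show ?case .
next
  case (backward S c v a w)
  have "c a = 0" using unit_path_props[OF backward(1)] backward(4,5) by metis
  then have "(\<Sum>b \<in> A. of_int ((c(a := -1)) b) * (h (head G b) - h (tail G b))) =
    (\<Sum>b \<in> A. of_int (c b) * (h (head G b) - h (tail G b)) + (if b = a then h w - h v else 0))"
    using backward(3,4) by (intro sum.cong) auto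
  also have "\<dots> = h w - h u" using backward assms(2) by (simp add: sum.distrib)
  finally show ?case .
qed simp

lemma unit_path_prefix:
  assumes "unit_path G A u S c v" "w \<in> S"
  shows "\<exists>S' c'. unit_path G A u S' c' w"
  using assms
proof induction
  case stay
  then show ?case using unit_path.stay[of G A u] by auto
next
  case (forward S c v a x)
  then show ?case using unit_path.forward[OF forward(1-5)] by blast
next
  case (backward S c v a x)
  then show ?case using unit_path.backward[OF backward(1-5)] by blast
qed

text \<open>If \<open>w\<close> was visited before, the path is cut back to it instead of extended.
  So the ends of unit paths are closed under the arcs of \<open>A\<close>, while the flow keeps to
  the values 0, 1 and -1.\<close>

lemma unit_path_extend:
  assumes "unit_path G A u S c v" "a \<in> A" "(tail G a, head G a) \<in> {(v, w), (w, v)}"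
  shows "\<exists>S' c'. unit_path G A u S' c' w"
proof (cases "w \<in> S")
  case True
  then show ?thesis using unit_path_prefix[OF assms(1)] by blast
next
  case False
  show ?thesis
  proof (cases "tail G a = v \<and> head G a = w")
    case True
    then show ?thesis using unit_path.forward[OF assms(1,2) _ _ False] by blast
  next
    case no: False
    then have "head G a = v" "tail G a = w" using assms(3) by auto
    then show ?thesis using unit_path.backward[OF assms(1,2) _ _ False] by blast
  qed
qed

text \<open>As \<open>e\<close> is not a bridge of \<open>C\<close>, a simple path leads from its
  head to its tail without using it, and \<open>e\<close> closes the path.\<close>

lemma cycle_unit_flow:
  fixes G C :: "('v, 'e) pre_digraph"
  assumes G: "fin_digraph G" and cyc: "is_cycle G C"
  obtains z :: "'e \<Rightarrow> int" and e where "e \<in> arcs C" "z e = 1" "\<And>a. \<bar>z a\<bar> \<le> 1"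
    "{a. z a \<noteq> 0} \<subseteq> arcs C"
    "\<And>h :: 'v \<Rightarrow> real. (\<Sum>a \<in> arcs G. of_int (z a) * (h (head G a) - h (tail G a))) = 0"
proof -
  have sub: "verts C \<subseteq> verts G" "arcs C \<subseteq> arcs G" "wf_digraph C" "tail C = tail G" "head C = head G"
    and conn: "Digraph_Component.connected C"
    and homeo: "graph_topology C (\<lambda>_. 1) homeomorphic_space top_of_set (sphere (0 :: complex) 1)"
    using cyc unfolding is_cycle_def subgraph_def by (auto simp: compatible_def)
  have finG: "finite (arcs G)" "finite (verts G)"
    using G by (auto simp: fin_digraph.finite_arcs fin_digraph.finite_verts)
  have "fin_digraph C"
    using sub finG by (auto simp: fin_digraph_def fin_digraph_axioms_def intro: finite_subset)
  then have C: "metric_graph C (\<lambda>_. 1)" using conn by (simp add: metric_graph_def)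
  interpret C: metric_graph C "\<lambda>_. 1" by (rule C)
  \<comment> \<open>Without arcs a path cannot move, but the circle has two different
    points.\<close>
  have "arcs C \<noteq> {}"
  proof
    assume none: "arcs C = {}"
    obtain \<phi> \<psi> where maps: "homeomorphic_maps (graph_topology C (\<lambda>_. 1)) (top_of_set (sphere (0 :: complex) 1)) \<phi> \<psi>"
      using homeo unfolding homeomorphic_space_def by blast
    have \<psi>: "\<psi> z \<in> points C (\<lambda>_. 1)" "\<phi> (\<psi> z) = z" if "z \<in> sphere 0 1" for z
      using maps that C.topspace_graph_topology unfolding homeomorphic_maps_def continuous_map_def by auto
    obtain L where "joined C (\<lambda>_. 1) (\<psi> 1) L (\<psi> (-1))"
      using C.joined_ex_points[OF \<psi>(1) \<psi>(1), of 1 "-1"] by auto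
    then have "\<psi> 1 = \<psi> (-1)" by cases (auto simp: none)
    then show False using \<psi>(2)[of 1] \<psi>(2)[of "-1"] by simp
  qed
  then obtain e where e: "e \<in> arcs C" by blast
  define A where "A = arcs C - {e}"
  define T where "T = {v. \<exists>S c. unit_path C A (head C e) S c v}"
  have "tail C a \<in> T \<longleftrightarrow> head C a \<in> T" if "a \<in> arcs C" "a \<noteq> e" for a
    using that unit_path_extend[of C A "head C e" _ _ _ a] unfolding T_def A_def by blast
  moreover have "head C e \<in> T" unfolding T_def using unit_path.stay[of C A "head C e"] by blast
  \<comment> \<open>Otherwise the complement of \<open>T\<close> would contain the tail but not the
    head, and \<open>e\<close> would be a bridge.\<close>
  ultimately have "tail C e \<in> T"
    using circle_no_bridge[OF C homeo e, of "- T"] by blast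
  then obtain S c where path: "unit_path C A (head C e) S c (tail C e)" unfolding T_def by blast
  note props = unit_path_props[OF path]
  define z where "z = c(e := 1)"
  have ce: "c a \<noteq> 0 \<Longrightarrow> a \<in> arcs C \<and> a \<noteq> e" for a using props unfolding A_def by blast
  have A: "finite A" unfolding A_def using C.finite_arcs by blast
  have "(\<Sum>a \<in> arcs G. of_int (z a) * (h (head G a) - h (tail G a))) = 0" for h :: "'v \<Rightarrow> real"
  proof -
    have "(\<Sum>a \<in> arcs G. of_int (z a) * (h (head G a) - h (tail G a))) =
      (\<Sum>a \<in> insert e A. of_int (z a) * (h (head G a) - h (tail G a)))"
      using finG sub(2) e ce unfolding z_def A_def by (intro sum.mono_neutral_right) auto
    also have "\<dots> = (h (head G e) - h (tail G e)) + (\<Sum>a \<in> A. of_int (c a) * (h (head G a) - h (tail G a)))"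
    proof (subst sum.insert)
      show "e \<notin> A" by (simp add: A_def)
      then show "of_int (z e) * (h (head G e) - h (tail G e)) +
          (\<Sum>a \<in> A. of_int (z a) * (h (head G a) - h (tail G a))) =
        h (head G e) - h (tail G e) + (\<Sum>a \<in> A. of_int (c a) * (h (head G a) - h (tail G a)))"
        by (auto simp: z_def intro!: sum.cong)
    qed (rule A)
    also have "\<dots> = 0" using unit_path_flow[OF path A, of h] sub by simp
    finally show ?thesis .
  qed
  moreover have "{a. z a \<noteq> 0} \<subseteq> arcs C" using ce e unfolding z_def by auto
  ultimately show ?thesis using that[OF e, of z] props by (auto simp: z_def)
qed

text \<open>An infimum of a nonempty set of \<open>enat\<close> is attained, and the empty set would
  give infinity, contrary to the bound by \<open>d\<close>.\<close>

lemma girth_cycle: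
  assumes "girth G \<le> enat d"
  obtains C where "is_cycle G C" "card (arcs C) \<le> d"
proof -
  let ?X = "(\<lambda>C. enat (card (arcs C))) ` {C. is_cycle G C}"
  have "?X \<noteq> {}"
  proof
    assume empty: "?X = {}"
    have "girth G = \<infinity>" unfolding girth_def empty by (simp add: top_enat_def)
    then show False using assms by simp
  qed
  then obtain x where "x \<in> ?X" by blast
  then have "girth G \<in> ?X"
    unfolding girth_def Inf_enat_def by (auto intro: LeastI[of "\<lambda>y. y \<in> ?X" x])
  then obtain C where "is_cycle G C" "girth G = enat (card (arcs C))" by blast
  then show ?thesis using that assms by simp
qed

section \<open>Principal divisors\<close>

context metric_graph begin

lemma PL_Z_lincomb:
  assumes "f \<in> PL_Z G len" "g \<in> PL_Z G len"
  shows "(\<lambda>x. f x + of_int c * g x) \<in> PL_Z G len"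
  using assms unfolding PL_Z_iff by (auto intro!: pl_on_lincomb)

lemma slope_sum_inner:
  assumes "e \<in> arcs G" "0 < t" "t < len e"
  shows "slope_sum G len f (Inner e t) = rslope (\<lambda>s. f (ep e s)) t - lslope (\<lambda>s. f (ep e s)) t"
proof -
  have "{(e', t'). e' \<in> arcs G \<and> 0 \<le> t' \<and> t' < len e' \<and> ep e' t' = Inner e t} = {(e, t)}"
    "{(e', t'). e' \<in> arcs G \<and> 0 < t' \<and> t' \<le> len e' \<and> ep e' t' = Inner e t} = {(e, t)}"
    using assms by (auto simp: edge_point_def split: if_splits)
  then show ?thesis unfolding slope_sum_def by simp
qed

lemma len_not_le_0: "e \<in> arcs G \<Longrightarrow> \<not> len e \<le> 0"
  using len_pos[of e] by simp

lemma slope_sum_vertex: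
  "slope_sum G len f (Vertex v) =
    (\<Sum>e \<in> {e \<in> arcs G. tail G e = v}. rslope (\<lambda>s. f (ep e s)) 0) -
    (\<Sum>e \<in> {e \<in> arcs G. head G e = v}. lslope (\<lambda>s. f (ep e s)) (len e))"
proof -
  have "{(e, t). e \<in> arcs G \<and> 0 \<le> t \<and> t < len e \<and> ep e t = Vertex v} =
    (\<lambda>e. (e, 0)) ` {e \<in> arcs G. tail G e = v}"
    using len_pos by (auto simp: edge_point_def len_not_le_0 split: if_splits)
  moreover have "{(e, t). e \<in> arcs G \<and> 0 < t \<and> t \<le> len e \<and> ep e t = Vertex v} =
    (\<lambda>e. (e, len e)) ` {e \<in> arcs G. head G e = v}"
    using len_pos by (auto simp: edge_point_def len_not_le_0 split: if_splits)
  ultimately show ?thesis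
    unfolding slope_sum_def by (simp add: sum.reindex inj_on_def sum_negf)
qed

text \<open>This justifies the floor in \<open>laplacian\<close>.\<close>

lemma slope_sum_Ints:
  assumes f: "f \<in> PL_Z G len" and x: "x \<in> points G len"
  shows "slope_sum G len f x \<in> \<int>"
  using x
proof (cases rule: points_cases)
  case (1 v)
  show ?thesis
    unfolding 1(1) slope_sum_vertex
    using pl_on_right(1)[OF PL_Z_pl_on[OF f], of _ 0] pl_on_left(1)[OF PL_Z_pl_on[OF f]] len_pos
    by (intro Ints_diff Ints_sum) auto
next
  case (2 e t)
  show ?thesis
    unfolding 2(1) slope_sum_inner[OF 2(2-4)]
    using pl_on_right(1)[OF PL_Z_pl_on[OF f 2(2)], of t] pl_on_left(1)[OF PL_Z_pl_on[OF f 2(2)], of t] 2(3,4)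
    by (intro Ints_diff) auto
qed

lemma slope_sum_lincomb:
  assumes f: "f \<in> PL_Z G len" and g: "g \<in> PL_Z G len" and x: "x \<in> points G len"
  shows "slope_sum G len (\<lambda>x. f x + c * g x) x = slope_sum G len f x + c * slope_sum G len g x"
  using x
proof (cases rule: points_cases)
  case (1 v)
  have "(\<Sum>e \<in> {e \<in> arcs G. tail G e = v}. rslope (\<lambda>s. f (ep e s) + c * g (ep e s)) 0) =
    (\<Sum>e \<in> {e \<in> arcs G. tail G e = v}. rslope (\<lambda>s. f (ep e s)) 0 + c * rslope (\<lambda>s. g (ep e s)) 0)"
    using rslope_lincomb[OF PL_Z_pl_on[OF f] PL_Z_pl_on[OF g]] len_pos by (intro sum.cong refl) auto
  moreover have "(\<Sum>e \<in> {e \<in> arcs G. head G e = v}. lslope (\<lambda>s. f (ep e s) + c * g (ep e s)) (len e)) =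
    (\<Sum>e \<in> {e \<in> arcs G. head G e = v}. lslope (\<lambda>s. f (ep e s)) (len e) + c * lslope (\<lambda>s. g (ep e s)) (len e))"
    using lslope_lincomb[OF PL_Z_pl_on[OF f] PL_Z_pl_on[OF g]] len_pos by (intro sum.cong refl) auto
  ultimately show ?thesis
    unfolding 1(1) slope_sum_vertex by (simp add: sum.distrib algebra_simps flip: sum_distrib_left)
next
  case (2 e t)
  show ?thesis
    unfolding 2(1) slope_sum_inner[OF 2(2-4)]
    using 2 rslope_lincomb[OF PL_Z_pl_on[OF f 2(2)] PL_Z_pl_on[OF g 2(2)], of t c]
      lslope_lincomb[OF PL_Z_pl_on[OF f 2(2)] PL_Z_pl_on[OF g 2(2)], of t c]
    by (simp add: algebra_simps)
qed

text \<open>The sum in \<open>laplacian\<close> would be 0 by convention over an infinite set. A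
  nonzero slope sum occurs only at a vertex or at one of the finitely many kinks.\<close>

lemma finite_slope_sum:
  assumes f: "f \<in> PL_Z G len"
  shows "finite {x \<in> points G len. slope_sum G len f x \<noteq> 0}"
proof (rule finite_subset)
  let ?K = "\<lambda>e. {t \<in> {0<..<len e}. rslope (\<lambda>s. f (ep e s)) t \<noteq> lslope (\<lambda>s. f (ep e s)) t}"
  show "{x \<in> points G len. slope_sum G len f x \<noteq> 0} \<subseteq> Vertex ` verts G \<union> (\<Union>e \<in> arcs G. Inner e ` ?K e)"
  proof
    fix x assume "x \<in> {x \<in> points G len. slope_sum G len f x \<noteq> 0}"
    then have "x \<in> points G len" and nz: "slope_sum G len f x \<noteq> 0" by auto
    then show "x \<in> Vertex ` verts G \<union> (\<Union>e \<in> arcs G. Inner e ` ?K e)"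
    proof (cases rule: points_cases)
      case (2 e t)
      then have "t \<in> ?K e" using nz slope_sum_inner[OF 2(2-4), of f] by simp
      then show ?thesis using 2(1,2) by blast
    qed blast
  qed
  show "finite (Vertex ` verts G \<union> (\<Union>e \<in> arcs G. Inner e ` ?K e))"
    using finite_verts finite_arcs finite_kinks[OF PL_Z_pl_on[OF f]]
    by (intro finite_UnI finite_imageI finite_UN_I) auto
qed

lemma lookup_laplacian:
  assumes f: "f \<in> PL_Z G len"
  shows "x \<in> points G len \<Longrightarrow> of_int (Poly_Mapping.lookup (laplacian G len f) x) = - slope_sum G len f x"
    and "x \<notin> points G len \<Longrightarrow> Poly_Mapping.lookup (laplacian G len f) x = 0"
proof -
  let ?X = "{x \<in> points G len. slope_sum G len f x \<noteq> 0}"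
  have "Poly_Mapping.lookup (laplacian G len f) x =
      - (\<Sum>y \<in> ?X. if y = x then \<lfloor>slope_sum G len f y\<rfloor> else 0)"
    unfolding laplacian_def lookup_uminus lookup_sum
    by (intro arg_cong[where f = uminus] sum.cong) (auto simp: lookup_single when_def)
  also have "\<dots> = - (if x \<in> ?X then \<lfloor>slope_sum G len f x\<rfloor> else 0)"
    using finite_slope_sum[OF f] by simp
  finally have *: "Poly_Mapping.lookup (laplacian G len f) x = - (if x \<in> ?X then \<lfloor>slope_sum G len f x\<rfloor> else 0)" .
  show "of_int (Poly_Mapping.lookup (laplacian G len f) x) = - slope_sum G len f x" if "x \<in> points G len"
    using * slope_sum_Ints[OF f that] that by (auto elim!: Ints_cases)
  show "Poly_Mapping.lookup (laplacian G len f) x = 0" if "x \<notin> points G len"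
    using * that by simp
qed

lemma laplacian_lincomb:
  assumes f: "f \<in> PL_Z G len" and g: "g \<in> PL_Z G len"
  shows "laplacian G len (\<lambda>x. f x + of_int c * g x) = laplacian G len f + frag_cmul c (laplacian G len g)"
proof (rule poly_mapping_eqI)
  fix x
  show "Poly_Mapping.lookup (laplacian G len (\<lambda>x. f x + of_int c * g x)) x =
    Poly_Mapping.lookup (laplacian G len f + frag_cmul c (laplacian G len g)) x"
  proof (cases "x \<in> points G len")
    case True
    have "real_of_int (Poly_Mapping.lookup (laplacian G len (\<lambda>x. f x + of_int c * g x)) x) =
      real_of_int (Poly_Mapping.lookup (laplacian G len f + frag_cmul c (laplacian G len g)) x)"
      using lookup_laplacian(1)[OF f True] lookup_laplacian(1)[OF g True]
        lookup_laplacian(1)[OF PL_Z_lincomb[OF f g] True] slope_sum_lincomb[OF f g True]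
      by (simp add: lookup_add)
    then show ?thesis by linarith
  next
    case False
    then show ?thesis
      using lookup_laplacian(2)[OF f False] lookup_laplacian(2)[OF g False]
        lookup_laplacian(2)[OF PL_Z_lincomb[OF f g] False] by (simp add: lookup_add)
  qed
qed

lemma zero_PL_Z: "(\<lambda>_. 0) \<in> PL_Z G len"
  unfolding PL_Z_iff by (auto intro!: pl_onI bexI[of _ 0])

text \<open>With \<open>c\<close> equal to 1 and -1 this covers the sums and differences that
  computing with cosets takes.\<close>

lemma principal_lincomb: "a \<in> principal G len \<Longrightarrow> b \<in> principal G len \<Longrightarrow> a + frag_cmul c b \<in> principal G len"
proof -
  assume "a \<in> principal G len" "b \<in> principal G len"
  then obtain f g where "f \<in> PL_Z G len" "a = laplacian G len f" "g \<in> PL_Z G len" "b = laplacian G len g"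
    unfolding principal_def by (elim imageE)
  then show ?thesis
    unfolding principal_def by (intro image_eqI[OF _ PL_Z_lincomb[of f g c]]) (simp_all only: laplacian_lincomb)
qed

lemma principal_zero: "0 \<in> principal G len"
proof -
  have "laplacian G len (\<lambda>_. 0) = 0"
    using laplacian_lincomb[OF zero_PL_Z zero_PL_Z, of "-1"] by simp
  then show ?thesis using zero_PL_Z unfolding principal_def by (intro image_eqI) auto
qed

lemma principal_add: "a \<in> principal G len \<Longrightarrow> b \<in> principal G len \<Longrightarrow> a + b \<in> principal G len"
  using principal_lincomb[of a b 1] by simp



section \<open>Divisor classes and torsion in the Jacobian\<close>

abbreviation divisor_class :: "(('v, 'e) gpoint \<Rightarrow>\<^sub>0 int) \<Rightarrow> (('v, 'e) gpoint \<Rightarrow>\<^sub>0 int) set" where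
  "divisor_class a \<equiv> principal G len #>\<^bsub>Div0 G len\<^esub> a"

lemma divisor_class_eq: "divisor_class a = (\<lambda>h. h + a) ` principal G len"
  unfolding r_coset_def Div0_def Div_def free_Abelian_group_def by auto

lemma divisor_class_eqD:
  assumes "divisor_class a = divisor_class b"
  shows "a - b \<in> principal G len"
proof -
  have "a \<in> divisor_class a" unfolding divisor_class_eq using principal_zero by force
  then show ?thesis unfolding assms unfolding divisor_class_eq by auto
qed

lemma divisor_class_principal:
  assumes "a \<in> principal G len"
  shows "divisor_class a = principal G len"
proof
  show "divisor_class a \<subseteq> principal G len"
    unfolding divisor_class_eq using principal_add assms by auto
  show "principal G len \<subseteq> divisor_class a"
  proof
    fix h assume "h \<in> principal G len"
    then have "h + frag_cmul (-1) a \<in> principal G len" using assms by (intro principal_lincomb)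
    then show "h \<in> divisor_class a" unfolding divisor_class_eq by (rule rev_image_eqI) simp
  qed
qed

text \<open>Sums are rearranged, using that \<open>principal\<close> contains 0 and is closed under
  addition. This makes powers in \<open>Jac\<close> computable on representatives.\<close>

lemma divisor_class_mult:
  "divisor_class a <#>\<^bsub>Div0 G len\<^esub> divisor_class b = divisor_class (a + b)"
proof
  show "divisor_class a <#>\<^bsub>Div0 G len\<^esub> divisor_class b \<subseteq> divisor_class (a + b)"
  proof
    fix x assume "x \<in> divisor_class a <#>\<^bsub>Div0 G len\<^esub> divisor_class b"
    then obtain h k where "h \<in> principal G len" "k \<in> principal G len" "x = (h + a) + (k + b)"
      unfolding set_mult_def divisor_class_eq by (auto simp: Div0_def Div_def free_Abelian_group_def)
    then show "x \<in> divisor_class (a + b)"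
      unfolding divisor_class_eq using principal_add[of h k]
      by (intro image_eqI[of _ _ "h + k"]) (auto simp: algebra_simps)
  qed
  show "divisor_class (a + b) \<subseteq> divisor_class a <#>\<^bsub>Div0 G len\<^esub> divisor_class b"
  proof
    fix x assume "x \<in> divisor_class (a + b)"
    then obtain h where h: "h \<in> principal G len" "x = (h + a) + (0 + b)"
      unfolding divisor_class_eq by (auto simp: algebra_simps)
    have "h + a \<in> divisor_class a" "0 + b \<in> divisor_class b"
      unfolding divisor_class_eq using h(1) principal_zero by blast+
    then show "x \<in> divisor_class a <#>\<^bsub>Div0 G len\<^esub> divisor_class b"
      unfolding h(2) set_mult_def by (force simp: Div0_def Div_def free_Abelian_group_def)
  qed
qed

lemma divisor_class_pow:
  "divisor_class a [^]\<^bsub>Jac G len\<^esub> (n :: nat) = divisor_class (frag_cmul (int n) a)"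
proof (induction n)
  case 0
  then show ?case using divisor_class_principal[OF principal_zero] by (simp add: Jac_def nat_pow_def)
next
  case (Suc n)
  then show ?case
    using divisor_class_mult[of "frag_cmul (int n) a" a]
    by (simp add: Jac_def nat_pow_def frag_cmul_distrib add.commute)
qed

lemma torsion_divisor_class:
  assumes "a \<in> carrier (Div0 G len)" "0 < n" "frag_cmul (int n) a \<in> principal G len"
  shows "divisor_class a \<in> torsion (Jac G len)"
proof -
  have "divisor_class a \<in> carrier (Jac G len)"
    unfolding Jac_def carrier_FactGroup using assms(1) by blast
  moreover have "divisor_class a [^]\<^bsub>Jac G len\<^esub> n = \<one>\<^bsub>Jac G len\<^esub>"
    using divisor_class_pow divisor_class_principal[OF assms(3)] by (simp add: Jac_def)
  ultimately show ?thesis unfolding torsion_def using assms(2) by blast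
qed

end

section \<open>Degree, support and coefficients of sums of points\<close>

lemma div_degree_superset:
  assumes "finite X" "Poly_Mapping.keys D \<subseteq> X"
  shows "div_degree D = (\<Sum>x \<in> X. Poly_Mapping.lookup D x)"
  unfolding div_degree_def using assms by (intro sum.mono_neutral_left) (auto simp: in_keys_iff)

lemma div_degree_diff: "div_degree (D - E) = div_degree D - div_degree E"
proof -
  let ?X = "Poly_Mapping.keys D \<union> Poly_Mapping.keys E"
  have "Poly_Mapping.keys (D - E) \<subseteq> ?X" by (rule keys_diff)
  then show ?thesis
    by (simp add: div_degree_superset[of ?X] lookup_minus sum_subtractf)
qed

lemma div_degree_add: "div_degree (D + E) = div_degree D + div_degree E"
  using div_degree_diff[of "D + E" E] by simp

lemma div_degree_frag_of: "div_degree (frag_of x) = 1"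
  by (simp add: div_degree_def)

lemma div_degree_sum: "div_degree (\<Sum>i\<in>I. frag_of (q i)) = int (card I)"
proof (induction I rule: infinite_finite_induct)
  case (insert i I)
  then show ?case by (simp add: div_degree_add div_degree_frag_of)
qed (simp_all add: div_degree_def)

lemma keys_sum_frag_of: "Poly_Mapping.keys (\<Sum>i\<in>I. frag_of (q i)) \<subseteq> q ` I"
proof (induction I rule: infinite_finite_induct)
  case (insert i I)
  then show ?case using keys_add[of "frag_of (q i)" "\<Sum>i\<in>I. frag_of (q i)"] by auto
qed simp_all

lemma lookup_sum_frag_of:
  "Poly_Mapping.lookup (\<Sum>i\<in>I. frag_of (q i)) x = (\<Sum>i\<in>I. if q i = x then 1 else 0)"
  unfolding lookup_sum by (intro sum.cong) (auto simp: lookup_single when_def)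

section \<open>Moving chips along a unit flow\<close>

text \<open>Kirchhoff's law in weak form: balance at each vertex is expressed as orthogonality to
  all potential differences. It is applied to the indicator of a vertex and to the vertex values of
  a piecewise linear function.\<close>

locale unit_flow = metric_graph G len
  for G :: "('v, 'e) pre_digraph" and len +
  fixes z :: "'e \<Rightarrow> int"
  assumes unit: "\<bar>z e\<bar> \<le> 1"
    and supp: "{e. z e \<noteq> 0} \<subseteq> arcs G"
    and flow: "(\<Sum>e \<in> arcs G. of_int (z e) * (h (head G e) - h (tail G e))) = (0 :: real)"
begin

abbreviation S :: "'e set" where "S \<equiv> {e. z e \<noteq> 0}"

definition start :: "'e \<Rightarrow> ('v, 'e) gpoint" where
  "start e = Vertex (if z e = 1 then tail G e else head G e)"

definition pos :: "real \<Rightarrow> 'e \<Rightarrow> real" where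
  "pos s e = (if z e = 1 then s * len e else (1 - s) * len e)"

text \<open>Writing \<open>Inner\<close> outright makes chips on different edges different terms, so
  coefficients can be read off; \<open>0 < s < 1\<close> ensures that the term is a point of the
  graph.\<close>

abbreviation moved :: "real \<Rightarrow> 'e \<Rightarrow> ('v, 'e) gpoint" where
  "moved s e \<equiv> Inner e (pos s e)"

lemma finite_S: "finite S"
  using supp finite_arcs by (rule finite_subset)

lemma z_cases:
  obtains "z e = 1" | "z e = -1" | "z e = 0"
  using unit[of e] by linarith

lemma pos_bounds:
  assumes "e \<in> arcs G" "0 < s" "s < 1"
  shows "0 < pos s e" "pos s e < len e"
  using assms len_pos[OF assms(1)] by (auto simp: pos_def)

lemma moved_in_points: "e \<in> S \<Longrightarrow> 0 < s \<Longrightarrow> s < 1 \<Longrightarrow> moved s e \<in> points G len"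
  using pos_bounds[of e s] supp by (auto simp: points_def)

lemma start_in_points: "e \<in> S \<Longrightarrow> start e \<in> points G len"
  using supp wf by (auto simp: points_def start_def wf_digraph.tail_in_verts wf_digraph.head_in_verts)

lemma lookup_moved_Inner:
  "Poly_Mapping.lookup (\<Sum>e\<in>S. frag_of (moved s e)) (Inner e t) = (if z e \<noteq> 0 \<and> t = pos s e then 1 else 0)"
proof -
  have "Poly_Mapping.lookup (\<Sum>e\<in>S. frag_of (moved s e)) (Inner e t) =
    (\<Sum>e'\<in>S. if e' = e then if t = pos s e then 1 else 0 else 0)"
    unfolding lookup_sum_frag_of by (intro sum.cong) auto
  then show ?thesis using finite_S by simp
qed

lemma lookup_moved_Vertex: "Poly_Mapping.lookup (\<Sum>e\<in>S. frag_of (moved s e)) (Vertex v) = 0"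
  unfolding lookup_sum_frag_of by simp

lemma lookup_start_Inner: "Poly_Mapping.lookup (\<Sum>e\<in>S. frag_of (start e)) (Inner e t) = 0"
  unfolding lookup_sum_frag_of by (simp add: start_def)

lemma lookup_outside:
  assumes "x \<notin> points G len" "\<And>e. e \<in> S \<Longrightarrow> q e \<in> points G len"
  shows "Poly_Mapping.lookup (\<Sum>e\<in>S. frag_of (q e)) x = 0"
  unfolding lookup_sum_frag_of using assms by (intro sum.neutral) auto

text \<open>
  The tent function on \<open>e\<close> with slopes \<open>n - 1\<close> and \<open>-1\<close> (seen from \<open>start e\<close>) has its peak
  at distance \<open>len e / n\<close> from \<open>start e\<close>, so that \<open>n\<close> times the peak is equivalent to
  \<open>n - 1\<close> times the start plus the end of \<open>e\<close>; the ends add up to the starts as \<open>z\<close> is a flow.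
\<close>

lemma moved_torsion:
  fixes n :: nat
  assumes n: "2 \<le> n"
  shows "frag_cmul (int n) ((\<Sum>e\<in>S. frag_of (moved (1 / n) e)) - (\<Sum>e\<in>S. frag_of (start e))) \<in> principal G len"
proof -
  \<comment> \<open>Parameters are counted from the tail. If the flow runs from head to tail, the
    tent is mirrored and the two slopes change places.\<close>
  define \<alpha> \<beta> :: "'e \<Rightarrow> real" where
    "\<alpha> = (\<lambda>e. if z e = 1 then real n - 1 else 1)" and "\<beta> = (\<lambda>e. if z e = 1 then 1 else real n - 1)"
  define f :: "('v, 'e) gpoint \<Rightarrow> real" where
    "f = (\<lambda>x. case x of Vertex v \<Rightarrow> 0
      | Inner e t \<Rightarrow> if z e = 0 then 0 else min (\<alpha> e * t) (\<beta> e * (len e - t)))"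
  have ab: "0 < \<alpha> e" "0 < \<beta> e" "\<alpha> e \<in> \<int>" "\<beta> e \<in> \<int>" "\<alpha> e + \<beta> e = n" for e
    using n by (auto simp: \<alpha>_def \<beta>_def)
  \<comment> \<open>The two lines of the tent meet exactly at the moved chip; the slope drops there
    by \<open>n\<close>, whence the coefficient \<open>n\<close>.\<close>
  have c: "(\<alpha> e + \<beta> e) * pos (1 / n) e = \<beta> e * len e" for e
    unfolding ab(5) using n by (simp add: pos_def \<beta>_def field_simps)
  have tent: "f (ep e t) = min (\<alpha> e * t) (\<beta> e * (len e - t))"
    if "e \<in> arcs G" "z e \<noteq> 0" "0 \<le> t" "t \<le> len e" for e t
    using that ab(1,2)[of e] len_pos[OF that(1)]
    by (auto simp: f_def edge_point_def min_def mult_le_0_iff)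
  have zero: "f (ep e t) = 0" if "z e = 0" for e t
    using that by (auto simp: f_def edge_point_def)
  note T = pl_on_tent[OF ab(1-4) len_pos c tent]
  have pl0: "pl_on l (\<lambda>_. 0)" for l by (auto intro!: pl_onI bexI[of _ 0])
  have f: "f \<in> PL_Z G len"
    unfolding PL_Z_iff
  proof
    fix e assume "e \<in> arcs G"
    then show "pl_on (len e) (\<lambda>t. f (ep e t))"
      using T(1)[of e] pl0 by (cases "z e = 0") (auto simp: zero)
  qed
  have slope0: "rslope (\<lambda>_. 0) t = 0" "lslope (\<lambda>_. 0) t = 0" for t
    by (rule rslope_eqI, simp, rule lslope_eqI, simp)
  have r: "rslope (\<lambda>s. f (ep e s)) t = (if z e = 0 then 0 else if t < pos (1 / n) e then \<alpha> e else - \<beta> e)"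
    if "e \<in> arcs G" "0 \<le> t" "t < len e" for e t
    using T(2)[of e] that by (cases "z e = 0") (simp_all add: zero slope0)
  have l: "lslope (\<lambda>s. f (ep e s)) t = (if z e = 0 then 0 else if t \<le> pos (1 / n) e then \<alpha> e else - \<beta> e)"
    if "e \<in> arcs G" "0 < t" "t \<le> len e" for e t
    using T(3)[of e] that by (cases "z e = 0") (simp_all add: zero slope0)
  have pos: "0 < pos (1 / n) e" "pos (1 / n) e < len e" if "e \<in> arcs G" for e
    using pos_bounds[OF that, of "1 / n"] n by auto
  have ends: "rslope (\<lambda>s. f (ep e s)) 0 = (if z e = 0 then 0 else \<alpha> e)"
    "lslope (\<lambda>s. f (ep e s)) (len e) = (if z e = 0 then 0 else - \<beta> e)" if "e \<in> arcs G" for e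
    using r[OF that, of 0] l[OF that, of "len e"] pos[OF that] len_pos[OF that] by auto
  have "laplacian G len f =
    frag_cmul (int n) ((\<Sum>e\<in>S. frag_of (moved (1 / n) e)) - (\<Sum>e\<in>S. frag_of (start e)))" (is "_ = ?R")
  proof (rule poly_mapping_eqI)
    fix x
    show "Poly_Mapping.lookup (laplacian G len f) x = Poly_Mapping.lookup ?R x"
    proof (cases "x \<in> points G len")
      case False
      have "Poly_Mapping.lookup (\<Sum>e\<in>S. frag_of (moved (1 / n) e)) x = 0"
        using n by (intro lookup_outside False moved_in_points) auto
      moreover have "Poly_Mapping.lookup (\<Sum>e\<in>S. frag_of (start e)) x = 0"
        by (intro lookup_outside False start_in_points)
      ultimately show ?thesis using lookup_laplacian(2)[OF f False] by (simp add: lookup_minus)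
    next
      case True
      have "- slope_sum G len f x = real_of_int (Poly_Mapping.lookup ?R x)"
        using True
      proof (cases rule: points_cases)
        case (2 e t)
        then show ?thesis
          using ab(5)[of e] by (simp add: lookup_minus lookup_moved_Inner lookup_start_Inner slope_sum_inner r l)
      next
        case (1 v)
        define i where "i = (\<lambda>w. if w = v then 1 else 0 :: real)"
        have "slope_sum G len f x = (\<Sum>e \<in> {e \<in> arcs G. tail G e = v}. if z e = 0 then 0 else \<alpha> e) -
          (\<Sum>e \<in> {e \<in> arcs G. head G e = v}. if z e = 0 then 0 else - \<beta> e)"
          unfolding 1(1) slope_sum_vertex
          by (intro arg_cong2[of _ _ _ _ "(-)"] sum.cong) (auto simp: ends)
        also have "\<dots> = (\<Sum>e \<in> arcs G. (if z e = 0 then 0 else \<alpha> e) * i (tail G e) + (if z e = 0 then 0 else \<beta> e) * i (head G e))"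
          unfolding sum.inter_filter[OF finite_arcs] sum_subtractf[symmetric]
          by (intro sum.cong refl) (auto simp: i_def)
        \<comment> \<open>Each arc of \<open>S\<close> gives \<open>n - 1\<close> at its start and 1
          at its end, that is \<open>n\<close> at its start plus its boundary; the boundaries cancel
          by \<open>flow\<close>.\<close>
        also have "\<dots> = (\<Sum>e \<in> arcs G. real n * (if z e \<noteq> 0 \<and> start e = x then 1 else 0) + of_int (z e) * (i (head G e) - i (tail G e)))"
        proof (intro sum.cong refl)
          fix e
          show "(if z e = 0 then 0 else \<alpha> e) * i (tail G e) + (if z e = 0 then 0 else \<beta> e) * i (head G e) =
            real n * (if z e \<noteq> 0 \<and> start e = x then 1 else 0) + of_int (z e) * (i (head G e) - i (tail G e))"
            by (cases rule: z_cases[of e]) (auto simp: \<alpha>_def \<beta>_def start_def i_def 1(1))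
        qed
        also have "\<dots> = real n * (\<Sum>e \<in> arcs G. if z e \<noteq> 0 \<and> start e = x then 1 else 0)"
          using flow[of i] by (simp add: sum.distrib sum_distrib_left)
        also have "(\<Sum>e \<in> arcs G. if z e \<noteq> 0 \<and> start e = x then 1 else 0 :: real) = (\<Sum>e \<in> S. if start e = x then 1 else 0)"
          using supp finite_arcs by (intro sum.mono_neutral_cong_right) auto
        finally show ?thesis
          using 1(1) by (simp add: lookup_minus lookup_moved_Vertex lookup_sum_frag_of of_int_sum if_distrib cong: if_cong)
      qed
      then show ?thesis using lookup_laplacian(1)[OF f True] by linarith
    qed
  qed
  then show ?thesis unfolding principal_def using f by (metis imageI)
qed

text \<open>
  Let \<open>m e\<close> be the slope of \<open>f\<close> at the ends of \<open>e\<close>, and \<open>\<delta> = s - s'\<close>. Both \<open>m\<close> and \<open>z\<close> are flows,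
  hence orthogonal to the increments \<open>len e * (m e + \<delta> * z e)\<close> of \<open>f\<close>. Together the two
  relations say that \<open>\<delta> * (\<delta> - 1) * (\<Sum>e. len e * z e ^ 2)\<close> equals the sum of the
  \<open>len e * m e * (m e + z e)\<close>, which are nonnegative because \<open>m\<close> is integral and \<open>z\<close> is a unit flow.
\<close>

lemma moved_not_equivalent:
  assumes s: "0 < s'" "s' < s" "s < 1" and ne: "S \<noteq> {}"
  shows "(\<Sum>e\<in>S. frag_of (moved s e)) - (\<Sum>e\<in>S. frag_of (moved s' e)) \<notin> principal G len"
proof
  assume "(\<Sum>e\<in>S. frag_of (moved s e)) - (\<Sum>e\<in>S. frag_of (moved s' e)) \<in> principal G len"
  then obtain f where f: "f \<in> PL_Z G len"
    and lap: "laplacian G len f = (\<Sum>e\<in>S. frag_of (moved s e)) - (\<Sum>e\<in>S. frag_of (moved s' e))"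
    unfolding principal_def by auto
  define \<delta> where "\<delta> = s - s'"
  define u where "u = (\<lambda>e t. f (ep e t))"
  define m where "m = (\<lambda>e. rslope (u e) 0)"
  have edge: "m e \<in> \<int> \<and> lslope (u e) (len e) = m e \<and> u e (len e) - u e 0 = len e * (m e + \<delta> * z e)"
    if e: "e \<in> arcs G" for e
  proof -
    \<comment> \<open>Against the orientation of \<open>e\<close>, the chip with the larger fraction
      has the smaller parameter, so the two positions are sorted.\<close>
    define a b where "a = min (pos s e) (pos s' e)" and "b = max (pos s e) (pos s' e)"
    have bounds: "0 < pos s e" "pos s e < len e" "0 < pos s' e" "pos s' e < len e"
      using pos_bounds[OF e] s by auto
    have ba: "b - a = \<delta> * len e"
    proof (cases "z e = 1")
      case True
      have "s' * len e < s * len e" using s len_pos[OF e] by simp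
      then show ?thesis using True by (simp add: a_def b_def pos_def \<delta>_def algebra_simps)
    next
      case False
      have "s' * len e < s * len e" using s len_pos[OF e] by simp
      then show ?thesis using False by (simp add: a_def b_def pos_def \<delta>_def algebra_simps)
    qed
    have ab: "0 < a" "a < b" "b < len e"
    proof -
      have "0 < \<delta> * len e" using s len_pos[OF e] by (simp add: \<delta>_def)
      then show "a < b" using ba by simp
    qed (use bounds in \<open>auto simp: a_def b_def\<close>)
    define w where "w = (\<lambda>t. min (max t a) b)"
    note W = pl_on_ramp[OF ab(2), where l = "len e", folded w_def]
    have u: "pl_on (len e) (u e)" unfolding u_def by (rule PL_Z_pl_on[OF f e])
    \<comment> \<open>The kinks of \<open>u e\<close> come from the two chips and match those of
      \<open>z e\<close> times the ramp, so \<open>v\<close> is affine on the entire edge. It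
      contributes \<open>len e * m e\<close> to the increment of \<open>u e\<close>, and the ramp
      contributes \<open>len e * \<delta> * z e\<close>.\<close>
    define v where "v = (\<lambda>t. u e t + (- of_int (z e)) * w t)"
    have v: "pl_on (len e) v" unfolding v_def using u W(1) by (intro pl_on_lincomb) auto
    have rv: "rslope v t = rslope (u e) t + (- of_int (z e)) * rslope w t" if "0 \<le> t" "t < len e" for t
      unfolding v_def by (rule rslope_lincomb[OF u W(1) that])
    have lv: "lslope v t = lslope (u e) t + (- of_int (z e)) * lslope w t" if "0 < t" "t \<le> len e" for t
      unfolding v_def by (rule lslope_lincomb[OF u W(1) that])
    have "rslope v t = lslope v t" if t: "0 < t" "t < len e" for t
    proof -
      have x: "Inner e t \<in> points G len" using e t by (auto simp: points_def)
      have "rslope (u e) t - lslope (u e) t = - real_of_int (Poly_Mapping.lookup (laplacian G len f) (Inner e t))"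
        unfolding lookup_laplacian(1)[OF f x] slope_sum_inner[OF e t] u_def by simp
      also have "\<dots> = (if z e \<noteq> 0 \<and> t = pos s' e then 1 else 0) - (if z e \<noteq> 0 \<and> t = pos s e then 1 else 0)"
        unfolding lap lookup_minus lookup_moved_Inner by simp
      also have "\<dots> = of_int (z e) * (rslope w t - lslope w t)"
      proof -
        have W': "rslope w t - lslope w t = (if t = a then 1 else 0) - (if t = b then 1 else 0)"
          using W(2)[of t] W(3)[of t] t ab by auto
        have less: "s' * len e < s * len e" using s len_pos[OF e] by simp
        show ?thesis unfolding W'
        proof (cases rule: z_cases[of e])
          case 1
          then have "a = pos s' e" "b = pos s e" using less by (simp_all add: a_def b_def pos_def)
          then show "(if z e \<noteq> 0 \<and> t = pos s' e then 1 else 0) - (if z e \<noteq> 0 \<and> t = pos s e then 1 else 0) =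
            of_int (z e) * ((if t = a then 1 else 0) - (if t = b then 1 else 0) :: real)" using 1 by simp
        next
          case 2
          then have "a = pos s e" "b = pos s' e" using less by (simp_all add: a_def b_def pos_def algebra_simps)
          then show "(if z e \<noteq> 0 \<and> t = pos s' e then 1 else 0) - (if z e \<noteq> 0 \<and> t = pos s e then 1 else 0) =
            of_int (z e) * ((if t = a then 1 else 0) - (if t = b then 1 else 0) :: real)" using 2 by simp
        qed simp
      qed
      finally show ?thesis using rv[of t] lv[of t] t by (simp add: algebra_simps)
    qed
    note aff = pl_on_affine[OF v order_refl len_pos[OF e] order_refl this]
    have ends: "rslope v 0 = m e" "lslope v (len e) = lslope (u e) (len e)"
      using rv[of 0] lv[of "len e"] W(2)[of 0] W(3)[of "len e"] ab len_pos[OF e] by (simp_all add: m_def)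
    have "w (len e) - w 0 = \<delta> * len e" using ab ba by (simp add: w_def)
    then have "u e (len e) - u e 0 = (v (len e) - v 0) + z e * (\<delta> * len e)"
      by (simp add: v_def algebra_simps flip: distrib_left)
    moreover have "v (len e) = v 0 + m e * (len e - 0)" using aff(1)[of "len e"] ends len_pos[OF e] by simp
    moreover have "m e \<in> \<int>" unfolding m_def using pl_on_right(1)[OF u, of 0] len_pos[OF e] by simp
    ultimately show ?thesis using aff(2) ends by (simp add: algebra_simps)
  qed
  define h where "h = (\<lambda>v. f (Vertex v))"
  have h: "h (head G e) - h (tail G e) = len e * (m e + \<delta> * z e)" if "e \<in> arcs G" for e
    using edge[OF that] len_pos[OF that] by (simp add: u_def h_def edge_point_def)
  \<comment> \<open>All chips are inside edges, so the slopes \<open>m\<close> balance at each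
    vertex; summation by parts turns this into orthogonality to the increments of
    \<open>h\<close>.\<close>
  have "(\<Sum>e \<in> arcs G. m e * (h (head G e) - h (tail G e))) = 0"
  proof -
    have "(\<Sum>e \<in> {e \<in> arcs G. tail G e = v}. m e) = (\<Sum>e \<in> {e \<in> arcs G. head G e = v}. m e)"
      if v: "v \<in> verts G" for v
    proof -
      have x: "Vertex v \<in> points G len" using v by (simp add: points_def)
      have "slope_sum G len f (Vertex v) = 0"
        using lookup_laplacian(1)[OF f x] unfolding lap lookup_minus lookup_moved_Vertex by simp
      moreover have "slope_sum G len f (Vertex v) =
        (\<Sum>e \<in> {e \<in> arcs G. tail G e = v}. m e) - (\<Sum>e \<in> {e \<in> arcs G. head G e = v}. m e)"
        unfolding slope_sum_vertex
        using edge by (intro arg_cong2[of _ _ _ _ "(-)"] sum.cong) (auto simp: m_def u_def)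
      ultimately show ?thesis by simp
    qed
    then have "(\<Sum>v \<in> verts G. h v * (\<Sum>e \<in> {e \<in> arcs G. tail G e = v}. m e)) =
      (\<Sum>v \<in> verts G. h v * (\<Sum>e \<in> {e \<in> arcs G. head G e = v}. m e))" by simp
    moreover have "(\<Sum>v \<in> verts G. h v * (\<Sum>e \<in> {e \<in> arcs G. k e = v}. m e)) = (\<Sum>e \<in> arcs G. h (k e) * m e)"
      if "k ` arcs G \<subseteq> verts G" for k
      unfolding sum_distrib_left sum.group[OF finite_arcs finite_verts that, of "\<lambda>e. h (k e) * m e", symmetric]
      by (intro sum.cong) auto
    ultimately show ?thesis
      using wf by (simp add: wf_digraph.tail_in_verts wf_digraph.head_in_verts image_subset_iff
        sum_subtractf right_diff_distrib mult.commute)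
  qed
  then have E1: "(\<Sum>e \<in> arcs G. m e * (len e * (m e + \<delta> * z e))) = 0" using h by simp
  have E2: "(\<Sum>e \<in> arcs G. z e * (len e * (m e + \<delta> * z e))) = 0" using flow[of h] h by simp
  define X Y Z where "X = (\<Sum>e \<in> arcs G. len e * (m e * m e))" and "Y = (\<Sum>e \<in> arcs G. len e * (m e * z e))"
    and "Z = (\<Sum>e \<in> arcs G. len e * (real_of_int (z e) * z e))"
  have 1: "X + \<delta> * Y = 0"
    using E1 unfolding X_def Y_def sum_distrib_left sum.distrib[symmetric] by (simp add: algebra_simps)
  have 2: "Y + \<delta> * Z = 0"
    using E2 unfolding Z_def Y_def sum_distrib_left sum.distrib[symmetric] by (simp add: algebra_simps)
  have 3: "0 \<le> X + Y"
    unfolding X_def Y_def sum.distrib[symmetric]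
  proof (rule sum_nonneg)
    fix e assume e: "e \<in> arcs G"
    obtain k where k: "m e = of_int k" using edge[OF e] by (auto elim: Ints_cases)
    \<comment> \<open>A nonzero integer \<open>k\<close> is at least as large in absolute value as
      \<open>z e\<close>, so \<open>k + z e\<close> cannot have the opposite sign.\<close>
    have "0 \<le> k * (k + z e)"
      using unit[of e] by (cases "0 < k"; cases "k < 0") (auto intro: mult_nonneg_nonneg mult_nonpos_nonpos)
    then have "0 \<le> m e * (m e + z e)" unfolding k by (metis of_int_0_le_iff of_int_add of_int_mult)
    then have "0 \<le> len e * (m e * (m e + z e))" using len_pos[OF e] by simp
    then show "0 \<le> len e * (m e * m e) + len e * (m e * z e)" by (simp add: algebra_simps)
  qed
  have 4: "0 < Z"
  proof -
    obtain e where e: "e \<in> S" using ne by blast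
    show ?thesis unfolding Z_def
    proof (rule sum_pos2[OF finite_arcs, of e])
      show "e \<in> arcs G" using e supp by blast
      then show "0 < len e * (real_of_int (z e) * z e)" using e len_pos by (cases rule: z_cases[of e]) auto
    qed (use len_pos in \<open>auto simp: less_imp_le\<close>)
  qed
  have "X + Y = \<delta> * (\<delta> - 1) * Z" using 1 2 by algebra
  \<comment> \<open>Here \<open>0 < \<delta> < 1\<close>, as both fractions lie strictly inside the
    unit interval.\<close>
  moreover have "\<delta> * (\<delta> - 1) * Z < 0"
    using 4 s by (intro mult_neg_pos mult_pos_neg) (auto simp: \<delta>_def)
  ultimately show False using 3 by simp
qed

end

section \<open>Infinitely many torsion classes in one Abel-Jacobi image\<close>

theorem mainTheorem5:
  fixes G :: "('v, 'e) pre_digraph" and len :: "'e \<Rightarrow> real" and d :: nat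
  assumes "fin_digraph G"
    and "Digraph_Component.connected G"
    and "\<forall>e \<in> arcs G. 0 < len e"
    and "girth G \<le> enat d"
  shows "\<not> manin_mumford G len d"
proof
  assume mm: "manin_mumford G len d"
  interpret metric_graph G len using assms(1-3) by (simp add: metric_graph_def)
  obtain C where C: "is_cycle G C" "card (arcs C) \<le> d" using girth_cycle[OF assms(4)] .
  then have sub: "arcs C \<subseteq> arcs G" by (simp add: is_cycle_def subgraph_def)
  obtain z :: "'e \<Rightarrow> int" and e where z: "e \<in> arcs C" "z e = 1" "\<And>a. \<bar>z a\<bar> \<le> 1"
    "{a. z a \<noteq> 0} \<subseteq> arcs C"
    "\<And>h :: 'v \<Rightarrow> real. (\<Sum>a \<in> arcs G. of_int (z a) * (h (head G a) - h (tail G a))) = 0"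
    by (rule cycle_unit_flow[OF assms(1) C(1)]) blast
  interpret unit_flow G len z
    using z(3-5) sub by (intro unit_flow.intro metric_graph_axioms unit_flow_axioms.intro) blast+
  have "z e \<noteq> 0" using z(2) by simp
  then have ne: "S \<noteq> {}" by blast
  obtain b where b: "bij_betw b {..<card S} S"
    using ex_bij_betw_nat_finite[OF finite_S] by (auto simp: atLeast0LessThan)
  \<comment> \<open>One chip is spent per edge of the flow: this is where the bound on the girth
    pays.\<close>
  have "card S \<le> card (arcs C)"
    by (rule card_mono[OF finite_subset[OF sub finite_arcs] z(4)])
  then have Sd: "card S \<le> d" using C(2) by simp
  obtain v0 where v0: "v0 \<in> verts G"
    using conn unfolding Digraph_Component.connected_def strongly_connected_def by (auto simp: mk_symmetric_def)
  \<comment> \<open>Spare chips rest at \<open>v0\<close>, the same for every \<open>q\<close>, so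
    they cancel in differences. Restricting to \<open>{..<d}\<close> puts the tuple into the
    extensional function space.\<close>
  define fill :: "('e \<Rightarrow> ('v, 'e) gpoint) \<Rightarrow> nat \<Rightarrow> ('v, 'e) gpoint" where
    "fill q = (\<lambda>i\<in>{..<d}. if i < card S then q (b i) else Vertex v0)" for q
  have fill_points: "fill q \<in> {..<d} \<rightarrow>\<^sub>E points G len" if "\<And>e. e \<in> S \<Longrightarrow> q e \<in> points G len" for q
    using that v0 bij_betwE[OF b] by (auto simp: fill_def points_def)
  have fill_diff: "(\<Sum>i<d. frag_of (fill q i)) - (\<Sum>i<d. frag_of (fill q' i)) =
    (\<Sum>e\<in>S. frag_of (q e)) - (\<Sum>e\<in>S. frag_of (q' e))" for q q'
  proof -
    have "(\<Sum>i<d. frag_of (fill q i)) - (\<Sum>i<d. frag_of (fill q' i)) =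
      (\<Sum>i<card S. frag_of (q (b i)) - frag_of (q' (b i)))"
      unfolding sum_subtractf[symmetric] using Sd
      by (intro sum.mono_neutral_cong_right) (auto simp: fill_def)
    also have "\<dots> = (\<Sum>e\<in>S. frag_of (q e) - frag_of (q' e))"
      by (rule sum.reindex_bij_betw[OF b])
    finally show ?thesis by (simp add: sum_subtractf)
  qed
  \<comment> \<open>With the starts and the spare chips as base divisor, the Abel-Jacobi image of
    the moved chips is the class of their displacement alone.\<close>
  define D where "D = (\<Sum>i<d. frag_of (fill start i))"
  have D: "D \<in> carrier (Div G len)" "effective D" "div_degree D = int d"
  proof -
    have "Poly_Mapping.keys D \<subseteq> fill start ` {..<d}" unfolding D_def by (rule keys_sum_frag_of)
    also have "\<dots> \<subseteq> points G len" using fill_points[of start, OF start_in_points] by auto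
    finally show "D \<in> carrier (Div G len)" by (simp add: Div_def free_Abelian_group_def)
    show "effective D" unfolding effective_def D_def lookup_sum_frag_of by (auto intro: sum_nonneg)
    show "div_degree D = int d" unfolding D_def div_degree_sum by simp
  qed
  define A where "A = (\<lambda>n :: nat. (\<Sum>e\<in>S. frag_of (moved (1 / n) e)) - (\<Sum>e\<in>S. frag_of (start e)))"
  have aj: "abel_jacobi G len d D (fill (moved (1 / real n))) = divisor_class (A n)" for n
    unfolding abel_jacobi_def D_def fill_diff A_def ..
  \<comment> \<open>From 2 on, \<open>1 / n\<close> is strictly between 0 and 1, so the moved chips
    are inside their edges.\<close>
  have moved_points: "moved (1 / real n) e \<in> points G len" if "2 \<le> n" "e \<in> S" for n e
    using that by (intro moved_in_points) auto
  have "divisor_class (A n) \<in> torsion (Jac G len)" if n: "2 \<le> n" for n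
  proof (rule torsion_divisor_class)
    show "0 < n" using n by simp
    show "frag_cmul (int n) (A n) \<in> principal G len" unfolding A_def by (rule moved_torsion[OF n])
    let ?M = "\<Sum>i<d. frag_of (fill (moved (1 / real n)) i)"
    have A: "A n = ?M - D" unfolding A_def D_def fill_diff ..
    have "Poly_Mapping.keys ?M \<subseteq> fill (moved (1 / real n)) ` {..<d}" by (rule keys_sum_frag_of)
    also have "\<dots> \<subseteq> points G len" using fill_points[of "moved (1 / real n)", OF moved_points[OF n]] by auto
    finally have "Poly_Mapping.keys (A n) \<subseteq> points G len"
      unfolding A using keys_diff[of ?M D] D(1) by (auto simp: Div_def free_Abelian_group_def)
    moreover have "div_degree (A n) = 0" unfolding A div_degree_diff D(3) div_degree_sum by simp
    ultimately show "A n \<in> carrier (Div0 G len)" by (simp add: Div0_def Div_def free_Abelian_group_def)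
  qed
  moreover have "divisor_class (A n) \<in> abel_jacobi G len d D ` ({..<d} \<rightarrow>\<^sub>E points G len)" if "2 \<le> n" for n
    unfolding aj[symmetric] by (intro imageI fill_points moved_points[OF that])
  ultimately have "(\<lambda>n. divisor_class (A n)) ` {2..} \<subseteq>
      abel_jacobi G len d D ` ({..<d} \<rightarrow>\<^sub>E points G len) \<inter> torsion (Jac G len)" by auto
  moreover have "finite (abel_jacobi G len d D ` ({..<d} \<rightarrow>\<^sub>E points G len) \<inter> torsion (Jac G len))"
    using mm D unfolding manin_mumford_def by blast
  ultimately have "finite ((\<lambda>n. divisor_class (A n)) ` {2..})" by (rule finite_subset)
  moreover have "inj_on (\<lambda>n. divisor_class (A n)) {2..}"
  proof (rule linorder_inj_onI')
    fix m n :: nat assume mn: "m \<in> {2..}" "n \<in> {2..}" "m < n"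
    \<comment> \<open>The starts cancel, and for \<open>m < n\<close> the larger fraction is
      \<open>1 / m\<close>.\<close>
    have "A m - A n \<notin> principal G len"
      using moved_not_equivalent[of "1 / real n" "1 / real m"] mn ne by (simp add: A_def frac_less2)
    then show "divisor_class (A m) \<noteq> divisor_class (A n)" using divisor_class_eqD by blast
  qed
  ultimately show False using finite_image_iff infinite_Ici by blast
qed

end
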